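(* Let $Y\subset\mathbb R$ be a non-empty subset with $\inf Y\notin Y$. For any non-empty $Y$-separated topological space $X$ the following hold. (1) $C_{\downarrow F}(X,Y)$ is Baire if and only if $X$ is discrete and the space $Y$ is Baire. (2) $C_{\downarrow F}(X,Y)$ is Choquet if and only if $X$ is discrete and $Y$ is almost Polish. (3) $C_{\downarrow F}(X,Y)$ is strong Choquet if and only if $X$ is discrete and $Y$ is Polish. (4) The following three conditions are equivalent: $C_{\downarrow F}(X,Y)$ is almost complete-metrizable; $C_{\downarrow F}(X,Y)$ is almost Polish; $X$ is countable and discrete and $Y$ is almost Polish. (5) The following three conditions are equivalent: $C_{\downarrow F}(X,Y)$ is complete-metrizable; $C_{\downarrow F}(X,Y)$ is Polish; $X$ is countable and discrete and $Y$ is Polish.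
   Context: Here $\inf Y$ is taken in $[-\infty,\infty]$ (so $\inf Y=-\infty\notin Y$ if $Y$ is unbounded below), and "countable" means at most countable. Fell hypograph topology: for a topological space $X$ and $Y\subset\mathbb R$, $C(X,Y)$ is the set of continuous functions $X\to Y$. $C_{\downarrow F}(X,Y)$ is $C(X,Y)$ endowed with the Fell hypograph topology: identify $f$ with its hypograph ${\downarrow}f=\{(x,y)\in X\times\mathbb R:y\le f(x)\}$ and take the topology inherited from the set of closed subsets of $X\times\mathbb R$ with the Fell topology (for a space $Z$ the Fell topology on closed subsets of $Z$ is generated by the subbase of sets $\{F:F\cap U\ne\emptyset\}$, $U\subset Z$ open, and $\{F:F\subset Z\setminus K\}$, $K\subset Z$ compact). For Hausdorff $X$ it is generated by the subbase of sets $\{f:\sup f(U)>y\}$ and $\{f:\max f(K)<y\}$, where $U\subset X$ is non-empty open, $K\subset X$ is non-empty compact and $y\in\mathbb R$. $X$ is $Y$-separated if for any distinct $x_1,x_2\in X$ and any $y_1,y_2\in Y$ there is a continuous $f:X\to Y$ with $f(x_i)=y_i$ for $i=1,2$. Choquet game on a space $Z$: players $\mathsf E$ and $\mathsf N$ alternately choose non-empty open sets $U_1\supset V_1\supset U_2\supset V_2\supset\cdots$ ($\mathsf E$ starts and chooses the $U_n$, $\mathsf N$ chooses the $V_n$); $\mathsf E$ wins if $\bigcap_nU_n=\emptyset$, otherwise $\mathsf N$ wins. Strong Choquet game: same, except that at the $n$-th inning $\mathsf E$ chooses an open $U_n\subset V_{n-1}$ (with $U_1$ any open set) together with a point $x_n\in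 U_n$, and $\mathsf N$ must choose an open $V_n$ with $x_n\in V_n\subset U_n$. $Z$ is Choquet (strong Choquet) if $\mathsf N$ has a winning strategy in the Choquet (strong Choquet) game on $Z$. A space is Baire if every countable intersection of open dense subsets is dense; Polish if homeomorphic to a separable complete metric space; almost Polish if it contains a dense Polish subspace; complete-metrizable if homeomorphic to a complete metric space; almost complete-metrizable if it contains a dense complete-metrizable subspace. *)

theory Defs
  imports "HOL-Analysis.Analysis"
begin

section \<open>Baire, Choquet and Polish spaces\<close>

definition baire_space :: "'a topology \<Rightarrow> bool" where
  "baire_space Z \<longleftrightarrow>
     (\<forall>\<U>. countable \<U> \<and> (\<forall>U\<in>\<U>. openin Z U \<and> Z closure_of U = topspace Z) \<longrightarrow>
        Z closure_of (topspace Z \<inter> \<Inter>\<U>) = topspace Z)"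

definition polish :: "'a topology \<Rightarrow> bool" where
  "polish Z \<longleftrightarrow> separable_space Z \<and> completely_metrizable_space Z"

definition almost_polish :: "'a topology \<Rightarrow> bool" where
  "almost_polish Z \<longleftrightarrow>
     (\<exists>D\<subseteq>topspace Z. Z closure_of D = topspace Z \<and> polish (subtopology Z D))"

definition almost_completely_metrizable_space :: "'a topology \<Rightarrow> bool" where
  "almost_completely_metrizable_space Z \<longleftrightarrow>
     (\<exists>D\<subseteq>topspace Z. Z closure_of D = topspace Z \<and>
        completely_metrizable_space (subtopology Z D))"

text \<open>
  In both games a play is indexed from 0, and a strategy of \<open>N\<close> maps the list of the moves made so
  far by \<open>E\<close> to an answer; the earlier answers of \<open>N\<close> are determined by that list and the strategy.
  A winning strategy must answer legally as long as \<open>E\<close> has moved legally, also in plays where \<open>E\<close>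
  moves illegally later on.
\<close>

definition answers :: "('m list \<Rightarrow> 'a set) \<Rightarrow> (nat \<Rightarrow> 'm) \<Rightarrow> nat \<Rightarrow> 'a set" where
  "answers \<sigma> m n = \<sigma> (map m [0..<Suc n])"

definition choquet_E_legal ::
  "'a topology \<Rightarrow> (nat \<Rightarrow> 'a set) \<Rightarrow> (nat \<Rightarrow> 'a set) \<Rightarrow> nat \<Rightarrow> bool" where
  "choquet_E_legal Z U V n \<longleftrightarrow>
     openin Z (U n) \<and> U n \<noteq> {} \<and> (\<forall>k. n = Suc k \<longrightarrow> U n \<subseteq> V k)"

definition choquet_winning_strategy :: "'a topology \<Rightarrow> ('a set list \<Rightarrow> 'a set) \<Rightarrow> bool" where
  "choquet_winning_strategy Z \<sigma> \<longleftrightarrow>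
     (\<forall>U. let V = answers \<sigma> U in
        (\<forall>n. (\<forall>i\<le>n. choquet_E_legal Z U V i) \<longrightarrow> openin Z (V n) \<and> V n \<noteq> {} \<and> V n \<subseteq> U n) \<and>
        ((\<forall>n. choquet_E_legal Z U V n) \<longrightarrow> (\<Inter>n. U n) \<noteq> {}))"

definition choquet_space :: "'a topology \<Rightarrow> bool" where
  "choquet_space Z \<longleftrightarrow> (\<exists>\<sigma>. choquet_winning_strategy Z \<sigma>)"

definition strong_choquet_E_legal ::
  "'a topology \<Rightarrow> (nat \<Rightarrow> 'a set \<times> 'a) \<Rightarrow> (nat \<Rightarrow> 'a set) \<Rightarrow> nat \<Rightarrow> bool" where
  "strong_choquet_E_legal Z m V n \<longleftrightarrow>
     openin Z (fst (m n)) \<and> snd (m n) \<in> fst (m n) \<and> (\<forall>k. n = Suc k \<longrightarrow> fst (m n) \<subseteq> V k)"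

definition strong_choquet_winning_strategy ::
  "'a topology \<Rightarrow> (('a set \<times> 'a) list \<Rightarrow> 'a set) \<Rightarrow> bool" where
  "strong_choquet_winning_strategy Z \<sigma> \<longleftrightarrow>
     (\<forall>m. let V = answers \<sigma> m in
        (\<forall>n. (\<forall>i\<le>n. strong_choquet_E_legal Z m V i) \<longrightarrow>
              openin Z (V n) \<and> snd (m n) \<in> V n \<and> V n \<subseteq> fst (m n)) \<and>
        ((\<forall>n. strong_choquet_E_legal Z m V n) \<longrightarrow> (\<Inter>n. fst (m n)) \<noteq> {}))"

definition strong_choquet_space :: "'a topology \<Rightarrow> bool" where
  "strong_choquet_space Z \<longleftrightarrow> (\<exists>\<sigma>. strong_choquet_winning_strategy Z \<sigma>)"


section \<open>The Fell hypograph topology\<close>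

text \<open>The points of the Fell topology are the closed sets of \<open>Z\<close>; see \<open>topspace_fell_topology\<close>.\<close>

definition fell_topology :: "'a topology \<Rightarrow> 'a set topology" where
  "fell_topology Z = topology_generated_by
     ({{F. closedin Z F \<and> F \<inter> U \<noteq> {}} |U. openin Z U} \<union>
      {{F. closedin Z F \<and> F \<subseteq> topspace Z - K} |K. compactin Z K})"

lemma topspace_fell_topology: "topspace (fell_topology Z) = {F. closedin Z F}"
proof -
  have "{F. closedin Z F \<and> F \<subseteq> topspace Z - {}} = {F. closedin Z F}"
    using closedin_subset by auto
  then have "{F. closedin Z F} \<in> {{F. closedin Z F \<and> F \<subseteq> topspace Z - K} |K. compactin Z K}"
    using compactin_empty by blast
  then show ?thesis
    unfolding fell_topology_def topology_generated_by_topspace by blast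
qed

text \<open>
  Functions on \<open>topspace X\<close> are represented by total functions with the value \<open>undefined\<close> outside of
  \<open>topspace X\<close>, so that a function is determined by its hypograph.
\<close>

definition continuous_functions :: "'a topology \<Rightarrow> real set \<Rightarrow> ('a \<Rightarrow> real) set" where
  "continuous_functions X Y = {f \<in> extensional (topspace X). continuous_map X (top_of_set Y) f}"

definition hypograph :: "'a topology \<Rightarrow> ('a \<Rightarrow> real) \<Rightarrow> ('a \<times> real) set" where
  "hypograph X f = {(x, y). x \<in> topspace X \<and> y \<le> f x}"

definition fell_hypograph_topology :: "'a topology \<Rightarrow> real set \<Rightarrow> ('a \<Rightarrow> real) topology" where
  "fell_hypograph_topology X Y =
     pullback_topology (continuous_functions X Y) (hypograph X)
       (fell_topology (prod_topology X euclideanreal))"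

lemma closedin_hypograph:
  assumes "continuous_map X euclideanreal f"
  shows "closedin (prod_topology X euclideanreal) (hypograph X f)"
proof -
  let ?P = "prod_topology X euclideanreal"
  have "continuous_map ?P euclideanreal (\<lambda>p. f (fst p) - snd p)"
    using continuous_map_compose[OF continuous_map_fst assms]
    by (intro continuous_map_diff) (auto simp: o_def continuous_map_snd)
  then have "closedin ?P {p \<in> topspace ?P. f (fst p) - snd p \<in> {0..}}"
    by (rule closedin_continuous_map_preimage) simp
  also have "{p \<in> topspace ?P. f (fst p) - snd p \<in> {0..}} = hypograph X f"
    by (auto simp: hypograph_def)
  finally show ?thesis .
qed

lemma inj_on_hypograph: "inj_on (hypograph X) (continuous_functions X Y)"
proof (rule inj_onI)
  fix f g
  assume f: "f \<in> continuous_functions X Y" and g: "g \<in> continuous_functions X Y"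
    and eq: "hypograph X f = hypograph X g"
  show "f = g"
  proof (rule extensionalityI)
    fix x assume "x \<in> topspace X"
    then have "y \<le> f x \<longleftrightarrow> y \<le> g x" for y
      using eq by (auto simp: hypograph_def set_eq_iff)
    then show "f x = g x" by (meson order_antisym order_refl)
  qed (use f g in \<open>auto simp: continuous_functions_def\<close>)
qed

lemma topspace_fell_hypograph_topology:
  "topspace (fell_hypograph_topology X Y) = continuous_functions X Y"
  unfolding fell_hypograph_topology_def topspace_pullback_topology topspace_fell_topology
  by (auto simp: continuous_functions_def continuous_map_in_subtopology intro: closedin_hypograph)

definition separated_by :: "real set \<Rightarrow> 'a topology \<Rightarrow> bool" where
  "separated_by Y X \<longleftrightarrow>
     (\<forall>x1\<in>topspace X. \<forall>x2\<in>topspace X. x1 \<noteq> x2 \<longrightarrow>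
        (\<forall>y1\<in>Y. \<forall>y2\<in>Y. \<exists>f. continuous_map X (top_of_set Y) f \<and> f x1 = y1 \<and> f x2 = y2))"

definition discrete_space :: "'a topology \<Rightarrow> bool" where
  "discrete_space X \<longleftrightarrow> X = discrete_topology (topspace X)"

end

theory Submission
  imports Defs
begin

text \<open>
  If \<open>x\<^sub>0\<close> is not isolated, lowering a function near \<open>x\<^sub>0\<close> destroys neither finitely many lower bounds on
  open sets nor upper bounds on compact sets. Hence every set \<open>{f. f x\<^sub>0 < q}\<close> with \<open>q > inf Y\<close> is open and
  dense, and countably many of them have empty intersection since \<open>inf Y \<notin> Y\<close>. So any of the completeness
  properties forces \<open>X\<close> to be discrete, and then the Fell hypograph topology is the product topology of
  \<open>Y\<^sup>X\<close>.

  Products of completely metrizable spaces are strong Choquet, and products of second countable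
  Baire spaces are Baire. Conversely, a winning strategy on a space that maps continuously and
  openly onto \<open>Y\<close> yields a countable tree of plays; the points of \<open>closure Y\<close> that can always be followed to
  a further node of the tree form a gdelta subset of \<open>Y\<close>. This subset is all of \<open>Y\<close> for the strong Choquet
  game and dense in \<open>Y\<close> for the Choquet game. A dense first countable subspace of \<open>Y\<^sup>X\<close> forces \<open>X\<close> to be
  countable.
\<close>

section \<open>Baire spaces and Choquet games\<close>

text \<open>Lowering is possible because hits are open: a hit by \<open>f\<close> persists at all
  points of some non-empty open set, which cannot be \<open>{x0}\<close> when \<open>x0\<close> is
  not isolated, so a witness away from \<open>x0\<close> can be kept. Separation then supplies the
  lowered function with values in \<open>Y\<close>.

  For discrete \<open>X\<close> two obstacles remain. An uncountable power of \<open>Y\<close> is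
  not metrizable, so completeness cannot be passed along a metric; the link to the line is a
  projection, which is continuous, open and onto. A strategy on the power covers uncountably many
  plays, whereas a gdelta set allows only countably many conditions; the Lindelof property of the
  line selects enough plays. Dually, the Baire property is not productive in general. Countable
  bases of the factors leave only countably many conditions on the value at each new coordinate, and
  then the Baire property of that single factor suffices.\<close>

lemma baire_space_residual:
  assumes "baire_space Z" and "countable \<P>"
    and "\<And>P Q. (P, Q) \<in> \<P> \<Longrightarrow> openin Z P \<and> openin Z Q \<and> P \<subseteq> Z closure_of Q"
  shows "Z closure_of (topspace Z \<inter> (\<Inter>(P, Q)\<in>\<P>. (topspace Z - P) \<union> Q)) = topspace Z"
proof -
  \<comment> \<open>The complement of \<open>P\<close> need not be open, so \<open>P\<close> is
    replaced by its closure. The resulting smaller set is open, and it is dense because an open set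
    that meets \<open>P\<close> also meets \<open>Q\<close>.\<close>
  define D where "D = (\<lambda>(P, Q). (topspace Z - Z closure_of P) \<union> Q)"
  have "openin Z (D (P, Q)) \<and> Z closure_of (D (P, Q)) = topspace Z" if "(P, Q) \<in> \<P>" for P Q
  proof
    note PQ = assms(3)[OF that]
    show "openin Z (D (P, Q))"
      using PQ by (auto simp: D_def intro!: openin_Un openin_diff)
    show "Z closure_of (D (P, Q)) = topspace Z"
      unfolding dense_intersects_open
    proof (intro allI impI)
      fix T assume T: "openin Z T \<and> T \<noteq> {}"
      show "D (P, Q) \<inter> T \<noteq> {}"
      proof (cases "T \<inter> P = {}")
        case True
        then have "T \<inter> Z closure_of P = {}"
          using T openin_Int_closure_of_eq_empty by blast
        then show ?thesis
          using T openin_subset[of Z T] by (auto simp: D_def)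
      next
        case False
        then have "T \<inter> Z closure_of Q \<noteq> {}"
          using PQ by blast
        then have "T \<inter> Q \<noteq> {}"
          using T openin_Int_closure_of_eq_empty by blast
        then show ?thesis
          by (auto simp: D_def)
      qed
    qed
  qed
  then have "Z closure_of (topspace Z \<inter> \<Inter>(D ` \<P>)) = topspace Z"
    using assms(1,2) unfolding baire_space_def by (metis (no_types, lifting) countable_image imageE surj_pair)
  moreover have "topspace Z \<inter> \<Inter>(D ` \<P>) \<subseteq> topspace Z \<inter> (\<Inter>(P, Q)\<in>\<P>. (topspace Z - P) \<union> Q)"
  proof -
    have "P \<subseteq> Z closure_of P" if "(P, Q) \<in> \<P>" for P Q
      using assms(3)[OF that] closure_of_subset openin_subset by metis
    then show ?thesis
      by (fastforce simp: D_def)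
  qed
  ultimately show ?thesis
    by (metis closure_of_mono closure_of_subset_topspace subset_antisym)
qed

text \<open>Continuity makes the preimage of an open set open, openness of \<open>f\<close> makes
  the preimage of a dense set dense, and surjectivity keeps the preimage of a non-empty open set
  non-empty.\<close>

lemma baire_space_open_map_image:
  assumes "baire_space Z" "continuous_map Z W f" "open_map Z W f" "f ` topspace Z = topspace W"
  shows "baire_space W"
  unfolding baire_space_def
proof (intro allI impI)
  fix \<U> assume \<U>: "countable \<U> \<and> (\<forall>U\<in>\<U>. openin W U \<and> W closure_of U = topspace W)"
  define pre where "pre = (\<lambda>U. {x \<in> topspace Z. f x \<in> U})"
  have "openin Z (pre U) \<and> Z closure_of (pre U) = topspace Z" if "U \<in> \<U>" for U
  proof
    show "openin Z (pre U)"
      using assms(2) \<U> that by (simp add: pre_def openin_continuous_map_preimage)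
    show "Z closure_of (pre U) = topspace Z"
      unfolding dense_intersects_open
    proof (intro allI impI)
      fix T assume T: "openin Z T \<and> T \<noteq> {}"
      then have "openin W (f ` T)" "f ` T \<noteq> {}"
        using assms(3) by (auto simp: open_map_def)
      then have "U \<inter> f ` T \<noteq> {}"
        using \<U> that dense_intersects_open[of W U] by blast
      then show "pre U \<inter> T \<noteq> {}"
        using T openin_subset[of Z T] by (auto simp: pre_def)
    qed
  qed
  then have dense: "Z closure_of (topspace Z \<inter> \<Inter>(pre ` \<U>)) = topspace Z"
    using assms(1) \<U> unfolding baire_space_def by (metis (no_types, lifting) countable_image imageE)
  show "W closure_of (topspace W \<inter> \<Inter>\<U>) = topspace W"
    unfolding dense_intersects_open
  proof (intro allI impI)
    fix T assume T: "openin W T \<and> T \<noteq> {}"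
    have "openin Z (pre T)"
      using assms(2) T by (simp add: pre_def openin_continuous_map_preimage)
    moreover have "pre T \<noteq> {}"
    proof -
      obtain y where "y \<in> T" "y \<in> f ` topspace Z"
        using T assms(4) openin_subset[of W T] by blast
      then show ?thesis
        by (auto simp: pre_def)
    qed
    ultimately obtain x where "x \<in> topspace Z" "x \<in> \<Inter>(pre ` \<U>)" "x \<in> pre T"
      using dense unfolding dense_intersects_open by blast
    then show "topspace W \<inter> \<Inter>\<U> \<inter> T \<noteq> {}"
      using assms(4) by (fastforce simp: pre_def)
  qed
qed

text \<open>
  Both games are treated at once as games in which \<open>E\<close> plays pointed open sets; the flag \<open>s\<close> of \<open>wins\<close> says
  whether \<open>N\<close> has to keep the point. The region of a history is where \<open>E\<close> has to play next.
\<close>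

definition legal_history ::
  "'a topology \<Rightarrow> (('a set \<times> 'a) list \<Rightarrow> 'a set) \<Rightarrow> ('a set \<times> 'a) list \<Rightarrow> bool" where
  "legal_history Z \<sigma> h \<longleftrightarrow>
     (\<forall>i<length h. openin Z (fst (h ! i)) \<and> snd (h ! i) \<in> fst (h ! i) \<and>
        (0 < i \<longrightarrow> fst (h ! i) \<subseteq> \<sigma> (take i h)))"

definition region :: "'a topology \<Rightarrow> ('m list \<Rightarrow> 'a set) \<Rightarrow> 'm list \<Rightarrow> 'a set" where
  "region Z \<sigma> h = (if h = [] then topspace Z else \<sigma> h)"

definition wins ::
  "bool \<Rightarrow> 'a topology \<Rightarrow> (('a set \<times> 'a) list \<Rightarrow> 'a set) \<Rightarrow> bool" where
  "wins s Z \<sigma> \<longleftrightarrow>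
     (\<forall>h. h \<noteq> [] \<and> legal_history Z \<sigma> h \<longrightarrow>
        openin Z (\<sigma> h) \<and> \<sigma> h \<noteq> {} \<and> \<sigma> h \<subseteq> fst (last h) \<and> (s \<longrightarrow> snd (last h) \<in> \<sigma> h)) \<and>
     (\<forall>m. (\<forall>n. legal_history Z \<sigma> (map m [0..<n])) \<longrightarrow> (\<Inter>n. fst (m n)) \<noteq> {})"

lemma legal_history_Nil [simp]: "legal_history Z \<sigma> []"
  by (simp add: legal_history_def)

lemma legal_history_snoc:
  "legal_history Z \<sigma> (h @ [m]) \<longleftrightarrow>
     legal_history Z \<sigma> h \<and> openin Z (fst m) \<and> snd m \<in> fst m \<and> fst m \<subseteq> region Z \<sigma> h"
proof -
  have "(h \<noteq> [] \<longrightarrow> fst m \<subseteq> \<sigma> h) \<longleftrightarrow> fst m \<subseteq> region Z \<sigma> h" if "openin Z (fst m)"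
    using openin_subset[OF that] by (cases h) (auto simp: region_def)
  then show ?thesis
    by (auto simp: legal_history_def nth_append less_Suc_eq)
qed

lemma legal_history_map:
  "legal_history Z \<sigma> (map m [0..<n]) \<longleftrightarrow> (\<forall>i<n. strong_choquet_E_legal Z m (answers \<sigma> m) i)"
proof -
  have "(0 < i \<longrightarrow> fst (m i) \<subseteq> \<sigma> (take i (map m [0..<n]))) \<longleftrightarrow>
      (\<forall>k. i = Suc k \<longrightarrow> fst (m i) \<subseteq> answers \<sigma> m k)" if "i < n" for i
    using that by (cases i) (simp_all add: take_map answers_def)
  then show ?thesis
    by (auto simp: legal_history_def strong_choquet_E_legal_def)
qed

lemma histories_eq_map:
  assumes "h 0 = []" "\<And>n. h (Suc n) = h n @ [m n]"
  shows "h n = map m [0..<n]"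
  using assms by (induction n) auto

lemma strong_choquet_wins:
  assumes "strong_choquet_winning_strategy Z \<sigma>"
  shows "wins True Z \<sigma>"
  unfolding wins_def
proof (intro conjI allI impI)
  note A = assms[unfolded strong_choquet_winning_strategy_def Let_def, rule_format]
  fix h assume h: "h \<noteq> [] \<and> legal_history Z \<sigma> h"
  define n where "n = length h - 1"
  have n: "Suc n = length h" using h by (simp add: n_def)
  \<comment> \<open>Beyond the end of \<open>h\<close> the moves \<open>m i\<close> are unspecified
    and possibly illegal. This is harmless, since a winning strategy answers legally as long as the
    moves so far are legal.\<close>
  define m where "m i = h ! i" for i
  have hm: "h = map m [0..<Suc n]"
    unfolding n m_def by (simp add: map_nth)
  then have "\<forall>i\<le>n. strong_choquet_E_legal Z m (answers \<sigma> m) i"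
    using h legal_history_map[of Z \<sigma> m "Suc n"] by simp
  then have B: "openin Z (answers \<sigma> m n) \<and> snd (m n) \<in> answers \<sigma> m n \<and> answers \<sigma> m n \<subseteq> fst (m n)"
    using conjunct1[OF A] by blast
  have "answers \<sigma> m n = \<sigma> h" using hm by (simp add: answers_def)
  moreover have "m n = last h" using hm by simp
  ultimately show "openin Z (\<sigma> h)" "\<sigma> h \<noteq> {}" "\<sigma> h \<subseteq> fst (last h)" "snd (last h) \<in> \<sigma> h"
    using B by auto
next
  fix m assume "\<forall>n. legal_history Z \<sigma> (map m [0..<n])"
  then have "\<forall>n. strong_choquet_E_legal Z m (answers \<sigma> m) n"
    unfolding legal_history_map by blast
  then show "(\<Inter>n. fst (m n)) \<noteq> {}"
    using assms unfolding strong_choquet_winning_strategy_def Let_def by blast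
qed

text \<open>The points are simply forgotten: a set that contains its point is non-empty, hence a
  legal move of the unpointed game.\<close>

lemma choquet_wins:
  assumes "choquet_winning_strategy Z \<sigma>"
  shows "wins False Z (\<lambda>h. \<sigma> (map fst h))"
  unfolding wins_def
proof (intro conjI allI impI)
  have ans: "answers (\<lambda>h. \<sigma> (map fst h)) m = answers \<sigma> (\<lambda>n. fst (m n))" for m
    by (auto simp: answers_def fun_eq_iff comp_def)
  have leg: "choquet_E_legal Z (\<lambda>n. fst (m n)) (answers \<sigma> (\<lambda>n. fst (m n))) i"
    if "strong_choquet_E_legal Z m (answers (\<lambda>h. \<sigma> (map fst h)) m) i" for m i
    using that by (auto simp: ans choquet_E_legal_def strong_choquet_E_legal_def)
  {
    fix h assume h: "h \<noteq> [] \<and> legal_history Z (\<lambda>h. \<sigma> (map fst h)) h"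
    define n where "n = length h - 1"
    have n: "Suc n = length h" using h by (simp add: n_def)
    define m where "m i = h ! i" for i
    have hm: "h = map m [0..<Suc n]"
      unfolding n m_def by (simp add: map_nth)
    then have "\<forall>i\<le>n. strong_choquet_E_legal Z m (answers (\<lambda>h. \<sigma> (map fst h)) m) i"
      using h legal_history_map[of Z _ m "Suc n"] by simp
    then have "\<forall>i\<le>n. choquet_E_legal Z (\<lambda>n. fst (m n)) (answers \<sigma> (\<lambda>n. fst (m n))) i"
      using leg by blast
    then have B: "openin Z (answers \<sigma> (\<lambda>n. fst (m n)) n) \<and> answers \<sigma> (\<lambda>n. fst (m n)) n \<noteq> {} \<and>
        answers \<sigma> (\<lambda>n. fst (m n)) n \<subseteq> fst (m n)"
      using assms unfolding choquet_winning_strategy_def Let_def by blast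
    have "answers \<sigma> (\<lambda>n. fst (m n)) n = \<sigma> (map fst h)" using hm by (simp add: answers_def comp_def)
    moreover have "m n = last h" using hm by simp
    ultimately show "openin Z (\<sigma> (map fst h))" "\<sigma> (map fst h) \<noteq> {}" "\<sigma> (map fst h) \<subseteq> fst (last h)"
      using B by auto
  }
  fix m assume "\<forall>n. legal_history Z (\<lambda>h. \<sigma> (map fst h)) (map m [0..<n])"
  then have "\<forall>n. choquet_E_legal Z (\<lambda>n. fst (m n)) (answers \<sigma> (\<lambda>n. fst (m n))) n"
    unfolding legal_history_map using leg by blast
  then show "(\<Inter>n. fst (m n)) \<noteq> {}"
    using assms unfolding choquet_winning_strategy_def Let_def by blast
qed simp

text \<open>\<open>N\<close> supplies the missing points: \<open>pt\<close> picks one in each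
  non-empty open set, and the pointed strategy is consulted with it.\<close>

lemma strong_choquet_imp_choquet:
  assumes "strong_choquet_space Z"
  shows "choquet_space Z"
proof -
  obtain \<sigma> where \<sigma>: "strong_choquet_winning_strategy Z \<sigma>"
    using assms by (auto simp: strong_choquet_space_def)
  define pt :: "'a set \<Rightarrow> 'a set \<times> 'a" where "pt = (\<lambda>U. (U, SOME x. x \<in> U))"
  have ans: "answers (\<lambda>h. \<sigma> (map pt h)) U = answers \<sigma> (\<lambda>n. pt (U n))" for U
    by (auto simp: answers_def fun_eq_iff comp_def)
  have fst_pt: "fst (pt A) = A" and snd_pt: "A \<noteq> {} \<Longrightarrow> snd (pt A) \<in> A" for A
    by (auto simp: pt_def some_in_eq)
  have leg: "strong_choquet_E_legal Z (\<lambda>n. pt (U n)) (answers \<sigma> (\<lambda>n. pt (U n))) i"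
    if "choquet_E_legal Z U (answers (\<lambda>h. \<sigma> (map pt h)) U) i" for U i
    using that snd_pt unfolding ans choquet_E_legal_def strong_choquet_E_legal_def fst_pt by blast
  have "choquet_winning_strategy Z (\<lambda>h. \<sigma> (map pt h))"
    unfolding choquet_winning_strategy_def Let_def
  proof (intro allI conjI)
    fix U n
    note A = \<sigma>[unfolded strong_choquet_winning_strategy_def Let_def, rule_format, of "\<lambda>n. pt (U n)"]
    show "(\<forall>i\<le>n. choquet_E_legal Z U (answers (\<lambda>h. \<sigma> (map pt h)) U) i) \<longrightarrow>
      openin Z (answers (\<lambda>h. \<sigma> (map pt h)) U n) \<and> answers (\<lambda>h. \<sigma> (map pt h)) U n \<noteq> {} \<and>
      answers (\<lambda>h. \<sigma> (map pt h)) U n \<subseteq> U n"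
      using conjunct1[OF A] leg[of U] unfolding ans fst_pt by blast
  next
    fix U
    note A = \<sigma>[unfolded strong_choquet_winning_strategy_def Let_def, rule_format, of "\<lambda>n. pt (U n)"]
    show "(\<forall>n. choquet_E_legal Z U (answers (\<lambda>h. \<sigma> (map pt h)) U) n) \<longrightarrow> (\<Inter>n. U n) \<noteq> {}"
      using conjunct2[OF A] leg[of U] unfolding ans fst_pt by blast
  qed
  then show ?thesis
    by (auto simp: choquet_space_def)
qed

text \<open>\<open>E\<close> starts inside \<open>W\<close> and plays the move number
  \<open>n\<close> inside \<open>G n\<close>; the point that \<open>N\<close> secures lies in
  \<open>W\<close> and in all \<open>G n\<close>. Only the sets are followed, so either value of
  \<open>s\<close> will do.\<close>

lemma wins_imp_baire_space:
  assumes "wins s Z \<sigma>"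
  shows "baire_space Z"
  unfolding baire_space_def
proof (intro allI impI)
  fix \<U> assume \<U>: "countable \<U> \<and> (\<forall>U\<in>\<U>. openin Z U \<and> Z closure_of U = topspace Z)"
  \<comment> \<open>The whole space is added so that the family to be enumerated is
    non-empty.\<close>
  define G where "G = from_nat_into (insert (topspace Z) \<U>)"
  have G: "openin Z (G n) \<and> Z closure_of (G n) = topspace Z" for n
    using \<U> from_nat_into[of "insert (topspace Z) \<U>" n] by (auto simp: G_def)
  have range_G: "range G = insert (topspace Z) \<U>"
    using \<U> by (simp add: G_def)
  show "Z closure_of (topspace Z \<inter> \<Inter>\<U>) = topspace Z"
    unfolding dense_intersects_open
  proof (intro allI impI)
    fix W assume W: "openin Z W \<and> W \<noteq> {}"
    define P where "P n h \<longleftrightarrow> length h = n \<and> legal_history Z \<sigma> h \<and> (h \<noteq> [] \<longrightarrow> fst (last h) \<subseteq> W)" for n h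
    define Q where "Q n h h' \<longleftrightarrow> (\<exists>m. h' = h @ [m] \<and> fst m \<subseteq> G n \<inter> W)" for n and h h' :: "('a set \<times> 'a) list"
    have "\<exists>h. P 0 h" by (auto simp: P_def)
    moreover have "\<exists>h'. P (Suc n) h' \<and> Q n h h'" if "P n h" for n h
    proof -
      define V where "V = region Z \<sigma> h \<inter> W"
      have "openin Z V \<and> V \<noteq> {}"
      proof (cases "h = []")
        case True
        then show ?thesis using W openin_subset[of Z W] by (auto simp: V_def region_def)
      next
        case False
        then have "openin Z (\<sigma> h) \<and> \<sigma> h \<noteq> {} \<and> \<sigma> h \<subseteq> W"
          using assms that unfolding wins_def P_def by (meson subset_trans)
        then show ?thesis using False W by (auto simp: V_def region_def)
      qed
      then obtain x where x: "x \<in> G n \<inter> V"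
        using G[of n] unfolding dense_intersects_open by blast
      have "openin Z (G n \<inter> V)"
        using G \<open>openin Z V \<and> V \<noteq> {}\<close> by blast
      then have "P (Suc n) (h @ [(G n \<inter> V, x)]) \<and> Q n h (h @ [(G n \<inter> V, x)])"
        using that x by (auto simp: P_def Q_def V_def legal_history_snoc)
      then show ?thesis by blast
    qed
    ultimately obtain h where h: "\<And>n. P n (h n)" "\<And>n. Q n (h n) (h (Suc n))"
      using dependent_nat_choice[of P Q] by blast
    then obtain m where m: "\<And>n. h (Suc n) = h n @ [m n]" "\<And>n. fst (m n) \<subseteq> G n \<inter> W"
      unfolding Q_def by metis
    have "h n = map m [0..<n]" for n
      using h(1)[of 0] m(1) by (intro histories_eq_map) (auto simp: P_def)
    then have "\<forall>n. legal_history Z \<sigma> (map m [0..<n])"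
      using h(1) by (auto simp: P_def)
    then obtain x where "x \<in> (\<Inter>n. fst (m n))"
      using assms unfolding wins_def by blast
    then have x: "x \<in> G n" "x \<in> W" for n
      using m(2) by blast+
    then have "x \<in> \<Inter>(insert (topspace Z) \<U>)"
      unfolding range_G[symmetric] by blast
    then show "topspace Z \<inter> \<Inter>\<U> \<inter> W \<noteq> {}"
      using x by auto
  qed
qed

lemma choquet_imp_baire_space: "choquet_space Z \<Longrightarrow> baire_space Z"
  unfolding choquet_space_def by (metis choquet_wins wins_imp_baire_space)

text \<open>The strategy on \<open>D\<close> is consulted with the traces of the moves; density
  keeps these traces non-empty.\<close>

lemma choquet_space_dense_subspace:
  assumes D: "D \<subseteq> topspace Z" "Z closure_of D = topspace Z"
    and "choquet_space (subtopology Z D)"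
  shows "choquet_space Z"
proof -
  obtain \<sigma> where \<sigma>: "choquet_winning_strategy (subtopology Z D) \<sigma>"
    using assms by (auto simp: choquet_space_def)
  define ext where "ext = (\<lambda>V. SOME W. openin Z W \<and> V = W \<inter> D)"
  have ext: "openin Z (ext V)" "V = ext V \<inter> D" if "openin (subtopology Z D) V" for V
    using someI_ex[of "\<lambda>W. openin Z W \<and> V = W \<inter> D"] that
    by (auto simp: openin_subtopology ext_def)
  \<comment> \<open>\<open>ext\<close> returns an arbitrary open set with the given trace on
    \<open>D\<close>, so it has to be cut down to the last move of \<open>E\<close> to be a legal
    answer. The trace of the answer does not change.\<close>
  define \<tau> where "\<tau> = (\<lambda>h. last h \<inter> ext (\<sigma> (map (\<lambda>U. U \<inter> D) h)))"
  have ans: "answers \<tau> U n = U n \<inter> ext (answers \<sigma> (\<lambda>n. U n \<inter> D) n)" for U n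
    by (simp add: answers_def \<tau>_def comp_def)
  have meets: "U \<inter> D \<noteq> {}" if "openin Z U" "U \<noteq> {}" for U
    using D(2) that unfolding dense_intersects_open by blast
  have good: "openin (subtopology Z D) (answers \<sigma> (\<lambda>n. U n \<inter> D) n) \<and>
      answers \<sigma> (\<lambda>n. U n \<inter> D) n \<noteq> {} \<and> answers \<sigma> (\<lambda>n. U n \<inter> D) n \<subseteq> U n \<inter> D"
    if "\<forall>i\<le>n. choquet_E_legal (subtopology Z D) (\<lambda>n. U n \<inter> D) (answers \<sigma> (\<lambda>n. U n \<inter> D)) i" for U n
    using that \<sigma> unfolding choquet_winning_strategy_def Let_def by blast
  have leg: "\<forall>i\<le>n. choquet_E_legal (subtopology Z D) (\<lambda>n. U n \<inter> D) (answers \<sigma> (\<lambda>n. U n \<inter> D)) i"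
    if "\<forall>i\<le>n. choquet_E_legal Z U (answers \<tau> U) i" for U n
    using that
  proof (induction n)
    case 0
    then show ?case
      using meets by (auto simp: choquet_E_legal_def openin_subtopology)
  next
    case (Suc n)
    then have IH: "\<forall>i\<le>n. choquet_E_legal (subtopology Z D) (\<lambda>n. U n \<inter> D) (answers \<sigma> (\<lambda>n. U n \<inter> D)) i"
      by simp
    have "answers \<sigma> (\<lambda>n. U n \<inter> D) n = ext (answers \<sigma> (\<lambda>n. U n \<inter> D) n) \<inter> D"
      using ext(2) good[OF IH] by blast
    moreover have "openin Z (U (Suc n))" "U (Suc n) \<noteq> {}" "U (Suc n) \<subseteq> answers \<tau> U n"
      using Suc.prems by (auto simp: choquet_E_legal_def)
    ultimately have "choquet_E_legal (subtopology Z D) (\<lambda>n. U n \<inter> D) (answers \<sigma> (\<lambda>n. U n \<inter> D)) (Suc n)"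
      using meets unfolding choquet_E_legal_def ans by (auto simp: openin_subtopology)
    then show ?case
      using IH le_Suc_eq by auto
  qed
  have "choquet_winning_strategy Z \<tau>"
    unfolding choquet_winning_strategy_def Let_def
  proof (intro allI conjI impI)
    fix U n assume U: "\<forall>i\<le>n. choquet_E_legal Z U (answers \<tau> U) i"
    note V = good[OF leg[OF U]]
    have "openin Z (U n)"
      using U by (auto simp: choquet_E_legal_def)
    then show "openin Z (answers \<tau> U n)"
      using V ext(1) by (auto simp: ans)
    show "answers \<tau> U n \<noteq> {}"
      using V ext(2) by (fastforce simp: ans)
    show "answers \<tau> U n \<subseteq> U n"
      by (auto simp: ans)
  next
    fix U assume "\<forall>n. choquet_E_legal Z U (answers \<tau> U) n"
    then have "\<forall>n. choquet_E_legal (subtopology Z D) (\<lambda>n. U n \<inter> D) (answers \<sigma> (\<lambda>n. U n \<inter> D)) n"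
      using leg by blast
    then have "(\<Inter>n. U n \<inter> D) \<noteq> {}"
      using \<sigma> unfolding choquet_winning_strategy_def Let_def by blast
    then show "(\<Inter>n. U n) \<noteq> {}"
      by blast
  qed
  then show ?thesis
    by (auto simp: choquet_space_def)
qed

section \<open>Completely metrizable spaces\<close>

text \<open>\<open>N\<close> only looks at the last move and the number of the inning. Since the
  closure of each answer lies in the move answered, a common point of the closures lies in all
  moves. The predicate \<open>B\<close> leaves open what small means, for balls as well as for
  boxes.\<close>

lemma strong_choquet_spaceI:
  assumes refine: "\<And>n U x. \<lbrakk>openin Z U; x \<in> U\<rbrakk> \<Longrightarrow>
      \<exists>V. openin Z V \<and> x \<in> V \<and> Z closure_of V \<subseteq> U \<and> B n V"
    and complete: "\<And>V. (\<And>n. openin Z (V n) \<and> V n \<noteq> {} \<and> B n (V n) \<and> Z closure_of (V (Suc n)) \<subseteq> V n) \<Longrightarrow>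
      (\<Inter>n. Z closure_of (V n)) \<noteq> {}"
  shows "strong_choquet_space Z"
proof -
  \<comment> \<open>In inning \<open>n\<close> the history has length \<open>Suc n\<close>, hence
    the subtraction in \<open>B (length h - 1) V\<close>.\<close>
  define \<sigma> where "\<sigma> = (\<lambda>h. SOME V. openin Z V \<and> snd (last h) \<in> V \<and>
      Z closure_of V \<subseteq> fst (last h) \<and> B (length h - 1) V)"
  have \<sigma>: "openin Z (answers \<sigma> m n) \<and> snd (m n) \<in> answers \<sigma> m n \<and>
      Z closure_of (answers \<sigma> m n) \<subseteq> fst (m n) \<and> B n (answers \<sigma> m n)"
    if "strong_choquet_E_legal Z m (answers \<sigma> m) n" for m n
  proof -
    have "answers \<sigma> m n = (SOME V. openin Z V \<and> snd (m n) \<in> V \<and> Z closure_of V \<subseteq> fst (m n) \<and> B n V)"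
      by (simp add: answers_def \<sigma>_def)
    moreover have "\<exists>V. openin Z V \<and> snd (m n) \<in> V \<and> Z closure_of V \<subseteq> fst (m n) \<and> B n V"
      using refine that by (auto simp: strong_choquet_E_legal_def)
    ultimately show ?thesis
      using someI_ex by (metis (mono_tags, lifting))
  qed
  have sub: "V \<subseteq> Z closure_of V" if "openin Z V" for V
    using that by (simp add: closure_of_subset openin_subset)
  have "strong_choquet_winning_strategy Z \<sigma>"
    unfolding strong_choquet_winning_strategy_def Let_def
  proof (intro allI conjI impI)
    fix m n assume "\<forall>i\<le>n. strong_choquet_E_legal Z m (answers \<sigma> m) i"
    then have "strong_choquet_E_legal Z m (answers \<sigma> m) n"
      by simp
    from \<sigma>[OF this] show "openin Z (answers \<sigma> m n)" "snd (m n) \<in> answers \<sigma> m n"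
      "answers \<sigma> m n \<subseteq> fst (m n)"
      using sub by blast+
  next
    fix m assume legal: "\<forall>n. strong_choquet_E_legal Z m (answers \<sigma> m) n"
    have "(\<Inter>n. Z closure_of (answers \<sigma> m n)) \<noteq> {}"
    proof (rule complete)
      fix n
      have "fst (m (Suc n)) \<subseteq> answers \<sigma> m n"
        using legal by (auto simp: strong_choquet_E_legal_def)
      then show "openin Z (answers \<sigma> m n) \<and> answers \<sigma> m n \<noteq> {} \<and> B n (answers \<sigma> m n) \<and>
          Z closure_of (answers \<sigma> m (Suc n)) \<subseteq> answers \<sigma> m n"
        using \<sigma>[of m n] \<sigma>[of m "Suc n"] legal by blast
    qed
    moreover have "Z closure_of (answers \<sigma> m n) \<subseteq> fst (m n)" for n
      using \<sigma>[of m n] legal by blast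
    ultimately show "(\<Inter>n. fst (m n)) \<noteq> {}"
      by blast
  qed
  then show ?thesis
    by (auto simp: strong_choquet_space_def)
qed

text \<open>A metric-free form of completeness: \<open>S n C\<close> stands for the diameter of \<open>C\<close> being small.\<close>

definition complete_smallness :: "'a topology \<Rightarrow> (nat \<Rightarrow> 'a set \<Rightarrow> bool) \<Rightarrow> bool" where
  "complete_smallness X S \<longleftrightarrow>
     (\<forall>n U x. openin X U \<and> x \<in> U \<longrightarrow>
        (\<exists>V. openin X V \<and> x \<in> V \<and> X closure_of V \<subseteq> U \<and> S n (X closure_of V))) \<and>
     (\<forall>C. decseq C \<and> (\<forall>n. closedin X (C n) \<and> C n \<noteq> {}) \<and> (\<exists>N. \<forall>n\<ge>N. S n (C n)) \<longrightarrow>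
        (\<Inter>n. C n) \<noteq> {})"

text \<open>Small of order \<open>n\<close> means contained in a closed ball of radius
  \<open>1 / 2 ^ n\<close>; the common point comes from Cantor's intersection theorem.\<close>

lemma completely_metrizable_imp_complete_smallness:
  assumes "completely_metrizable_space X"
  shows "\<exists>S. complete_smallness X S"
proof -
  obtain M d where "Metric_space M d" and comp: "Metric_space.mcomplete M d"
    and X: "X = Metric_space.mtopology M d"
    using assms unfolding completely_metrizable_space_def by blast
  interpret Metric_space M d by fact
  define S where "S n C \<longleftrightarrow> (\<exists>a. C \<subseteq> mcball a (1 / 2 ^ n))" for n :: nat and C
  have "\<exists>V. openin X V \<and> x \<in> V \<and> X closure_of V \<subseteq> U \<and> S n (X closure_of V)"
    if U: "openin X U" "x \<in> U" for n U x
  proof -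
    obtain r where r: "r > 0" "mcball x r \<subseteq> U"
      using U unfolding X openin_mtopology_mcball by blast
    have x: "x \<in> M"
      using U openin_subset[of X U] by (auto simp: X)
    define q where "q = min r (1 / 2 ^ n)"
    have q: "q > 0" "q \<le> r" "q \<le> 1 / 2 ^ n"
      using r by (auto simp: q_def)
    have cl: "X closure_of (mball x q) \<subseteq> mcball x q"
      unfolding X by (intro closure_of_minimal mball_subset_mcball closedin_mcball)
    moreover have "mcball x q \<subseteq> mcball x r" "mcball x q \<subseteq> mcball x (1 / 2 ^ n)"
      using q by (auto intro: mcball_subset_concentric)
    ultimately show ?thesis
      using r x q unfolding X S_def
      by (intro exI[of _ "mball x q"]) (auto intro: subset_trans)
  qed
  moreover have "(\<Inter>n. C n) \<noteq> {}"
    if C: "decseq C" "\<forall>n. closedin X (C n) \<and> C n \<noteq> {}" "\<exists>N. \<forall>n\<ge>N. S n (C n)" for C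
  proof -
    have "\<exists>n a. C n \<subseteq> mcball a \<epsilon>" if \<epsilon>: "\<epsilon> > 0" for \<epsilon>
    proof -
      obtain N where N: "\<And>n. n \<ge> N \<Longrightarrow> S n (C n)"
        using C(3) by blast
      obtain k where k: "(1 / 2 :: real) ^ k < \<epsilon>"
        using real_arch_pow_inv[OF \<epsilon>, of "1 / 2"] by auto
      have "(1 / 2 :: real) ^ max N k \<le> (1 / 2) ^ k"
        by (rule power_decreasing) auto
      then have "1 / 2 ^ max N k \<le> \<epsilon>"
        using k by (simp add: power_one_over)
      moreover obtain a where "C (max N k) \<subseteq> mcball a (1 / 2 ^ max N k)"
        using N[of "max N k"] by (auto simp: S_def)
      ultimately show ?thesis
        using mcball_subset_concentric[of "1 / 2 ^ max N k" \<epsilon> a] by blast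
    qed
    then show ?thesis
      using comp C(1,2) unfolding mcomplete_nest X by blast
  qed
  ultimately have "complete_smallness X S"
    unfolding complete_smallness_def by blast
  then show ?thesis by blast
qed

lemma completely_metrizable_imp_strong_choquet:
  assumes "completely_metrizable_space X"
  shows "strong_choquet_space X"
proof -
  obtain S where S: "complete_smallness X S"
    using completely_metrizable_imp_complete_smallness[OF assms] by blast
  show ?thesis
  proof (rule strong_choquet_spaceI[where B = "\<lambda>n V. S n (X closure_of V)"])
    show "\<exists>V. openin X V \<and> x \<in> V \<and> X closure_of V \<subseteq> U \<and> S n (X closure_of V)"
      if "openin X U" "x \<in> U" for n U x
      using S that unfolding complete_smallness_def by blast
    fix V :: "nat \<Rightarrow> 'a set"
    assume V: "\<And>n. openin X (V n) \<and> V n \<noteq> {} \<and> S n (X closure_of (V n)) \<and> X closure_of (V (Suc n)) \<subseteq> V n"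
    have sub: "V n \<subseteq> X closure_of (V n)" for n
      using V by (simp add: closure_of_subset openin_subset)
    have "decseq (\<lambda>n. X closure_of (V n))"
      using V sub by (intro decseq_SucI) blast
    moreover have "closedin X (X closure_of (V n)) \<and> X closure_of (V n) \<noteq> {}" for n
      using V[of n] sub[of n] by auto
    ultimately show "(\<Inter>n. X closure_of (V n)) \<noteq> {}"
      using V conjunct2[OF S[unfolded complete_smallness_def], rule_format, of "\<lambda>n. X closure_of (V n)"]
      by auto
  qed
qed

text \<open>\<open>N\<close> answers with boxes whose sides are either whole factors or small. The
  boxes decrease, so a side once restricted stays restricted and is small from then on, while a side
  never restricted imposes nothing. This is why \<open>complete_smallness\<close> asks for smallness
  only from some index on.\<close>

lemma strong_choquet_product_completely_metrizable:
  assumes cm: "\<And>i. i \<in> I \<Longrightarrow> completely_metrizable_space (X i)"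
  shows "strong_choquet_space (product_topology X I)"
proof -
  obtain S where S: "\<And>i. i \<in> I \<Longrightarrow> complete_smallness (X i) (S i)"
  proof -
    have "\<forall>i\<in>I. \<exists>S. complete_smallness (X i) S"
      using completely_metrizable_imp_complete_smallness[OF cm] by blast
    then have "\<exists>S. \<forall>i\<in>I. complete_smallness (X i) (S i)"
      by (rule bchoice)
    then show ?thesis
      using that by blast
  qed
  define B where "B n V \<longleftrightarrow> (\<exists>W. V = Pi\<^sub>E I W \<and>
      (\<forall>i\<in>I. openin (X i) (W i) \<and> (W i = topspace (X i) \<or> S i n (X i closure_of W i))))" for n V
  show ?thesis
  proof (rule strong_choquet_spaceI[where B = B])
    fix n U x assume "openin (product_topology X I) U" "x \<in> U"
    then obtain W0 where W0: "finite {i \<in> I. W0 i \<noteq> topspace (X i)}"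
      "\<And>i. i \<in> I \<Longrightarrow> openin (X i) (W0 i)" "x \<in> Pi\<^sub>E I W0" "Pi\<^sub>E I W0 \<subseteq> U"
      unfolding openin_product_topology_alt by metis
    \<comment> \<open>Coordinates left free by \<open>W0\<close> stay free; shrinking them too would
      restrict infinitely many sides, and the box would no longer be open.\<close>
    have "\<forall>i\<in>I. \<exists>V. openin (X i) V \<and> x i \<in> V \<and> X i closure_of V \<subseteq> W0 i \<and>
        (W0 i = topspace (X i) \<longrightarrow> V = topspace (X i)) \<and>
        (V = topspace (X i) \<or> S i n (X i closure_of V))"
    proof
      fix i assume i: "i \<in> I"
      have "x i \<in> W0 i"
        using W0(3) i by blast
      show "\<exists>V. openin (X i) V \<and> x i \<in> V \<and> X i closure_of V \<subseteq> W0 i \<and>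
          (W0 i = topspace (X i) \<longrightarrow> V = topspace (X i)) \<and>
          (V = topspace (X i) \<or> S i n (X i closure_of V))"
      proof (cases "W0 i = topspace (X i)")
        case True
        then show ?thesis
          using \<open>x i \<in> W0 i\<close> by (intro exI[of _ "topspace (X i)"]) auto
      next
        case False
        then show ?thesis
          using S[OF i] W0(2)[OF i] \<open>x i \<in> W0 i\<close> unfolding complete_smallness_def by metis
      qed
    qed
    then obtain W where W: "\<And>i. i \<in> I \<Longrightarrow> openin (X i) (W i) \<and> x i \<in> W i \<and> X i closure_of W i \<subseteq> W0 i \<and>
        (W0 i = topspace (X i) \<longrightarrow> W i = topspace (X i)) \<and>
        (W i = topspace (X i) \<or> S i n (X i closure_of W i))"
      by metis
    have "{i \<in> I. W i \<noteq> topspace (X i)} \<subseteq> {i \<in> I. W0 i \<noteq> topspace (X i)}"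
      using W by blast
    then have "openin (product_topology X I) (Pi\<^sub>E I W)"
      using W finite_subset[OF _ W0(1)] unfolding openin_PiE_gen by auto
    moreover have "product_topology X I closure_of Pi\<^sub>E I W \<subseteq> U"
      unfolding closure_of_product_topology
      by (rule subset_trans[OF PiE_mono W0(4)]) (use W in auto)
    moreover have "x \<in> Pi\<^sub>E I W"
      using W W0(3) by (auto simp: PiE_iff)
    moreover have "B n (Pi\<^sub>E I W)"
      using W unfolding B_def by blast
    ultimately show "\<exists>V. openin (product_topology X I) V \<and> x \<in> V \<and> product_topology X I closure_of V \<subseteq> U \<and> B n V"
      by blast
  next
    fix V assume V: "\<And>n. openin (product_topology X I) (V n) \<and> V n \<noteq> {} \<and> B n (V n) \<and>
        product_topology X I closure_of V (Suc n) \<subseteq> V n"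
    then have "\<forall>n. \<exists>W. V n = Pi\<^sub>E I W \<and>
      (\<forall>i\<in>I. openin (X i) (W i) \<and> (W i = topspace (X i) \<or> S i n (X i closure_of W i)))"
      unfolding B_def by blast
    then obtain W where VW: "\<And>n. V n = Pi\<^sub>E I (W n)"
      and W: "\<And>n i. i \<in> I \<Longrightarrow> openin (X i) (W n i) \<and> (W n i = topspace (X i) \<or> S i n (X i closure_of W n i))"
      by metis
    have ne: "W n i \<noteq> {}" if "i \<in> I" for n i
      using V[of n] that unfolding VW by (auto simp: PiE_eq_empty_iff)
    have sub: "W n i \<subseteq> X i closure_of W n i" if "i \<in> I" for n i
      using W[OF that] by (simp add: closure_of_subset openin_subset)
    \<comment> \<open>Inclusion of boxes passes to the sides because the smaller box is
      non-empty.\<close>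
    have step: "X i closure_of W (Suc n) i \<subseteq> W n i" if "i \<in> I" for n i
    proof -
      have "(\<Pi>\<^sub>E i\<in>I. X i closure_of W (Suc n) i) \<subseteq> Pi\<^sub>E I (W n)"
        using V[of n] unfolding VW closure_of_product_topology by blast
      moreover have "(\<Pi>\<^sub>E i\<in>I. X i closure_of W (Suc n) i) \<noteq> {}"
        using ne[of _ "Suc n"] sub[of _ "Suc n"] unfolding PiE_eq_empty_iff by blast
      ultimately show ?thesis
        using that unfolding subset_PiE by blast
    qed
    have inter: "(\<Inter>n. X i closure_of W n i) \<noteq> {}" if i: "i \<in> I" for i
    proof (cases "\<forall>n. W n i = topspace (X i)")
      case True
      then show ?thesis
        using ne[OF i] by simp
    next
      case False
      then obtain N where N: "W N i \<noteq> topspace (X i)"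
        by blast
      have dec: "decseq (\<lambda>n. W n i)"
        using step[OF i] sub[OF i] by (intro decseq_SucI) blast
      have "W n i \<noteq> topspace (X i)" if "n \<ge> N" for n
        using decseqD[OF dec that] N W[OF i, of N] openin_subset[of "X i" "W N i"] by blast
      then have "\<forall>n\<ge>N. S i n (X i closure_of W n i)"
        using W[OF i] by blast
      moreover have "decseq (\<lambda>n. X i closure_of W n i)"
        using dec by (intro decseq_SucI closure_of_mono) (simp add: decseq_Suc_iff)
      moreover have "closedin (X i) (X i closure_of W n i) \<and> X i closure_of W n i \<noteq> {}" for n
        using ne[OF i, of n] sub[OF i, of n] by auto
      ultimately show ?thesis
        using conjunct2[OF S[OF i, unfolded complete_smallness_def], rule_format, of "\<lambda>n. X i closure_of W n i"]
        by auto
    qed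
    define z where "z i = (SOME y. y \<in> (\<Inter>n. X i closure_of W n i))" for i
    have z: "z i \<in> X i closure_of W n i" if "i \<in> I" for i n
      using inter[OF that] unfolding some_in_eq[symmetric] z_def by blast
    then have "restrict z I \<in> (\<Inter>n. product_topology X I closure_of V n)"
      unfolding VW closure_of_product_topology by auto
    then show "(\<Inter>n. product_topology X I closure_of V n) \<noteq> {}"
      by blast
  qed
qed

section \<open>From winning strategies to gdelta sets\<close>

text \<open>Along a play in the tree the images under \<open>f\<close> shrink to one point, and the
  point that the winning \<open>N\<close> secures is mapped onto it. So a real number that can be
  followed through the tree lies in \<open>Y\<close>, although it was only taken from
  \<open>closure Y\<close>.\<close>

lemma wins_imp_gdelta_kernel:
  fixes Y :: "real set"
  assumes wins: "wins s Z \<sigma>"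
    and f: "continuous_map Z (top_of_set Y) f" "open_map Z (top_of_set Y) f" "f ` topspace Z = Y"
  obtains G where "gdelta_in euclidean G" "G \<subseteq> Y" "s \<Longrightarrow> G = Y"
    "baire_space (top_of_set Y) \<Longrightarrow> Y \<subseteq> closure G"
proof -
  define R where "R h = region Z \<sigma> h" for h
  have R: "openin Z (R h)" if "legal_history Z \<sigma> h" for h
    using wins that by (auto simp: R_def region_def wins_def)
  \<comment> \<open>The images of the regions are open only relative to \<open>Y\<close>; extending
    them to open sets of the line makes sense of following a point not yet known to be in
    \<open>Y\<close>.\<close>
  have "\<exists>V. open V \<and> (legal_history Z \<sigma> h \<longrightarrow> V \<inter> Y = f ` R h)" for h
  proof (cases "legal_history Z \<sigma> h")
    case True
    then have "openin (top_of_set Y) (f ` R h)"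
      using R f(2) by (simp add: open_map_def)
    then show ?thesis
      by (metis openin_open inf_commute)
  qed auto
  then obtain V where V: "\<And>h. open (V h)" "\<And>h. legal_history Z \<sigma> h \<Longrightarrow> V h \<inter> Y = f ` R h"
    by metis
  have R_snoc: "R (h @ [m]) \<noteq> {} \<and> R (h @ [m]) \<subseteq> fst m \<and> (s \<longrightarrow> snd m \<in> R (h @ [m]))"
    if "legal_history Z \<sigma> (h @ [m])" for h m
    using conjunct1[OF wins[unfolded wins_def], rule_format, of "h @ [m]"] that
    by (simp add: R_def region_def)
  \<comment> \<open>The radius depends on the length of the history, so that the images of the moves
    of an infinite play shrink to a point.\<close>
  define child where "child h m \<longleftrightarrow> openin Z (fst m) \<and> snd m \<in> fst m \<and> fst m \<subseteq> R h \<and>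
      (\<exists>c. f ` fst m \<subseteq> ball c ((1 / 2) ^ length h))" for h m
  have legal_child: "legal_history Z \<sigma> (h @ [m])" if "legal_history Z \<sigma> h" "child h m" for h m
    using that by (auto simp: legal_history_snoc child_def R_def)
  \<comment> \<open>Lindelof: countably many children cover as much of the line as all of them.
    Hence the tree is countable and the set built from it is a gdelta.\<close>
  have "\<exists>K. countable K \<and> K \<subseteq> Collect (child h) \<and>
      (\<Union>m\<in>K. V (h @ [m])) = (\<Union>m\<in>Collect (child h). V (h @ [m]))" for h
  proof -
    obtain \<F> where \<F>: "\<F> \<subseteq> (\<lambda>m. V (h @ [m])) ` Collect (child h)" "countable \<F>"
      "\<Union>\<F> = \<Union>((\<lambda>m. V (h @ [m])) ` Collect (child h))"
      using Lindelof[of "(\<lambda>m. V (h @ [m])) ` Collect (child h)"] V(1) by blast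
    then obtain K where "countable K" "K \<subseteq> Collect (child h)" "\<F> = (\<lambda>m. V (h @ [m])) ` K"
      using iffD1[OF countable_subset_image, OF conjI[OF \<F>(2,1)]] by blast
    with \<F>(3) show ?thesis
      by (intro exI[of _ K]) simp
  qed
  then obtain kids where kids: "\<And>h. countable (kids h)" "\<And>h. kids h \<subseteq> Collect (child h)"
    "\<And>h. (\<Union>m\<in>kids h. V (h @ [m])) = (\<Union>m\<in>Collect (child h). V (h @ [m]))"
    by metis
  define W where "W h = (\<Union>m\<in>kids h. V (h @ [m]))" for h
  have W: "open (W h)" for h
    using V(1) by (auto simp: W_def)
  \<comment> \<open>\<open>E\<close> can play an arbitrarily small neighbourhood of any point
    \<open>x\<close> of the region, with \<open>x\<close> as its point; the minimum respects both
    the requested \<open>e\<close> and the bound in \<open>child\<close>.\<close>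
  have dense: "\<exists>m. child h m \<and> f ` fst m \<subseteq> ball (f x) e \<and> snd m = x"
    if "legal_history Z \<sigma> h" "x \<in> R h" "e > 0" for h x e
  proof -
    define U where "U = R h \<inter> {z \<in> topspace Z. f z \<in> Y \<inter> ball (f x) (min e ((1 / 2) ^ length h))}"
    have x: "x \<in> topspace Z" "f x \<in> Y"
      using R[OF that(1)] that(2) openin_subset f(3) by blast+
    have "openin (top_of_set Y) (Y \<inter> ball (f x) (min e ((1 / 2) ^ length h)))"
      by (simp add: openin_open_Int)
    then have "openin Z U"
      using openin_Int[OF R[OF that(1)] openin_continuous_map_preimage[OF f(1)]]
      unfolding U_def by blast
    moreover have "x \<in> U"
      using that x by (simp add: U_def)
    moreover have "f ` U \<subseteq> ball (f x) (min e ((1 / 2) ^ length h))"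
      by (auto simp: U_def)
    then have "f ` U \<subseteq> ball (f x) e" "f ` U \<subseteq> ball (f x) ((1 / 2) ^ length h)"
      by auto
    ultimately have "child h (U, x) \<and> f ` fst (U, x) \<subseteq> ball (f x) e \<and> snd (U, x) = x"
      by (auto simp: child_def U_def)
    then show ?thesis by blast
  qed
  \<comment> \<open>The answer to a small move around \<open>x\<close> stays near \<open>x\<close>
    but may avoid it, so \<open>W h\<close> is only known to come arbitrarily close to
    \<open>f x\<close>.\<close>
  have VW: "V h \<inter> Y \<subseteq> closure (W h \<inter> Y)" if h: "legal_history Z \<sigma> h" for h
  proof
    fix y assume "y \<in> V h \<inter> Y"
    then obtain x where x: "x \<in> R h" "y = f x"
      using V(2)[OF h] by blast
    show "y \<in> closure (W h \<inter> Y)"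
      unfolding closure_approachable
    proof (intro allI impI)
      fix e :: real assume "e > 0"
      then obtain m where m: "child h m" "f ` fst m \<subseteq> ball (f x) e"
        using dense[OF h x(1)] by blast
      note l = legal_child[OF h m(1)]
      obtain z where "f z \<in> V (h @ [m]) \<inter> Y" "z \<in> fst m"
        using R_snoc[OF l] V(2)[OF l] by blast
      moreover have "V (h @ [m]) \<subseteq> W h"
        using m(1) kids(3)[of h] by (auto simp: W_def)
      moreover have "dist (f z) y < e"
        using m(2) \<open>z \<in> fst m\<close> x(2) by (auto simp: dist_commute)
      ultimately show "\<exists>y'\<in>W h \<inter> Y. dist y' y < e"
        by blast
    qed
  qed
  \<comment> \<open>Here the answer has to keep \<open>x\<close>, so \<open>f x\<close> itself is
    covered by a child.\<close>
  have VW': "V h \<inter> Y \<subseteq> W h" if h: "legal_history Z \<sigma> h" and s for h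
  proof
    fix y assume "y \<in> V h \<inter> Y"
    then obtain x where x: "x \<in> R h" "y = f x"
      using V(2)[OF h] by blast
    obtain m where m: "child h m" "snd m = x"
      using dense[OF h x(1), of 1] by auto
    have l: "legal_history Z \<sigma> (h @ [m])"
      using legal_child[OF h m(1)] .
    have "x \<in> R (h @ [m])"
      using R_snoc[OF l] \<open>s\<close> m(2) by blast
    then have "y \<in> V (h @ [m])"
      using V(2)[OF l] x(2) by blast
    then show "y \<in> W h"
      using m(1) kids(3)[of h] unfolding W_def by blast
  qed
  define H where "H n = ((\<lambda>S. \<Union>h\<in>S. (\<lambda>m. h @ [m]) ` kids h) ^^ n) {[]}" for n
  have H0: "H 0 = {[]}" and HSuc: "H (Suc n) = (\<Union>h\<in>H n. (\<lambda>m. h @ [m]) ` kids h)" for n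
    by (simp_all add: H_def)
  have cH: "countable (H n)" for n
    by (induction n) (auto simp: H0 HSuc kids(1))
  have lH: "legal_history Z \<sigma> h \<and> length h = n" if "h \<in> H n" for h n
    using that
  proof (induction n arbitrary: h)
    case (Suc n)
    then obtain h' m where "h' \<in> H n" "m \<in> kids h'" "h = h' @ [m]"
      by (auto simp: HSuc)
    then show ?case
      using Suc.IH legal_child kids(2) by fastforce
  qed (simp add: H0)
  define T where "T = (\<Union>n. H n)"
  have cT: "countable T" and lT: "\<And>h. h \<in> T \<Longrightarrow> legal_history Z \<sigma> h" and "[] \<in> T"
    using cH lH H0 by (auto simp: T_def)
  \<comment> \<open>A point of \<open>G\<close> in \<open>V h\<close> always lies in \<open>V\<close> of some child of \<open>h\<close>; this replaces the usual
     point-finite covers and Koenig's lemma.\<close>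
  define G where "G = closure Y \<inter> V [] \<inter> (\<Inter>h\<in>T. - V h \<union> W h)"
  have V_Nil: "Y \<subseteq> V []"
    using V(2)[of "[]"] f(3) by (auto simp: R_def region_def)
  have "gdelta_in euclidean G"
  proof -
    have cl: "gdelta_in euclidean C" if "closed C" for C :: "real set"
      using closed_imp_gdelta_in[of euclidean C] that metrizable_space_euclidean by simp
    have op: "gdelta_in euclidean U" if "open U" for U :: "real set"
      using open_imp_gdelta_in[of euclidean U] that by simp
    have "gdelta_in euclidean (\<Inter>h\<in>T. - V h \<union> W h)"
    proof (rule gdelta_in_Inter)
      show "gdelta_in euclidean S" if "S \<in> (\<lambda>h. - V h \<union> W h) ` T" for S
        using that V(1) W by (auto intro: gdelta_in_Un[OF cl op])
    qed (use cT \<open>[] \<in> T\<close> in auto)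
    then show ?thesis
      unfolding G_def using V(1) by (intro gdelta_in_Int) (auto intro: cl op)
  qed
  moreover have "G \<subseteq> Y"
  proof
    fix z assume z: "z \<in> G"
    have "\<exists>h. h 0 = [] \<and> (\<forall>n. (h n \<in> H n \<and> z \<in> V (h n)) \<and> (\<exists>m\<in>kids (h n). h (Suc n) = h n @ [m]))"
    proof -
      have "\<exists>h. h \<in> H 0 \<and> z \<in> V h"
        using z by (auto simp: H0 G_def)
      moreover have "\<exists>h'. (h' \<in> H (Suc n) \<and> z \<in> V h') \<and> (\<exists>m\<in>kids h. h' = h @ [m])"
        if "h \<in> H n \<and> z \<in> V h" for h n
      proof -
        have "z \<in> W h"
          using z that by (auto simp: G_def T_def)
        then obtain m where "m \<in> kids h" "z \<in> V (h @ [m])"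
          by (auto simp: W_def)
        then show ?thesis
          using that by (auto simp: HSuc)
      qed
      ultimately obtain h where "\<And>n. h n \<in> H n \<and> z \<in> V (h n)" "\<And>n. \<exists>m\<in>kids (h n). h (Suc n) = h n @ [m]"
        using dependent_nat_choice[of "\<lambda>n h. h \<in> H n \<and> z \<in> V h" "\<lambda>n h h'. \<exists>m\<in>kids h. h' = h @ [m]"]
        by blast
      moreover from this(1)[of 0] have "h 0 = []"
        by (simp add: H0)
      ultimately show ?thesis
        by blast
    qed
    then obtain h where h: "h 0 = []" "\<And>n. h n \<in> H n" "\<And>n. z \<in> V (h n)"
      and "\<And>n. \<exists>m\<in>kids (h n). h (Suc n) = h n @ [m]"
      by blast
    then obtain m where m: "\<And>n. m n \<in> kids (h n)" "\<And>n. h (Suc n) = h n @ [m n]"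
      by metis
    have hm: "h n = map m [0..<n]" for n
      using h(1) m(2) by (rule histories_eq_map)
    have "legal_history Z \<sigma> (map m [0..<n])" for n
      using lH[OF h(2)[of n]] hm by simp
    then obtain p where p: "\<And>n. p \<in> fst (m n)"
      using conjunct2[OF wins[unfolded wins_def], rule_format, of m] by blast
    \<comment> \<open>\<open>z\<close> is a limit of images of the answer to \<open>m n\<close>, and
      \<open>f p\<close> is an image of a point of the move itself; both images lie in one ball
      around \<open>c\<close>. Three distances below \<open>e / 4\<close> lead from \<open>z\<close>
      over \<open>y\<close> and \<open>c\<close> to \<open>f p\<close>.\<close>
    have "dist z (f p) < e" if e: "e > 0" for e
    proof -
      obtain n where n: "(1 / 2) ^ n < e / 4"
        using real_arch_pow_inv[of "e / 4" "1 / 2"] e by auto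
      have len: "length (h n) = n"
        using lH[OF h(2)] by blast
      obtain c where c: "f ` fst (m n) \<subseteq> ball c ((1 / 2) ^ n)"
        using m(1)[of n] kids(2)[of "h n"] unfolding child_def len by blast
      have l: "legal_history Z \<sigma> (h (Suc n))"
        using lH h(2) by blast
      then have "R (h (Suc n)) \<subseteq> fst (m n)"
        using R_snoc[of "h n" "m n"] m(2)[of n] by simp
      then have "V (h (Suc n)) \<inter> Y \<subseteq> ball c ((1 / 2) ^ n)"
        using V(2)[OF l] c by blast
      \<comment> \<open>An open set around a point of \<open>closure Y\<close> has that point in the
        closure of its trace on \<open>Y\<close>; this is why \<open>G\<close> starts from
        \<open>closure Y\<close>.\<close>
      moreover have "z \<in> closure (V (h (Suc n)) \<inter> Y)"
        using h(3)[of "Suc n"] V(1) z open_Int_closure_subset by (fastforce simp: G_def)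
      then obtain y where "y \<in> V (h (Suc n)) \<inter> Y" "dist y z < e / 4"
        using e unfolding closure_approachable by (meson divide_pos_pos zero_less_numeral)
      moreover have "f p \<in> ball c ((1 / 2) ^ n)"
        using c p by blast
      ultimately have "dist c y < e / 4" "dist c (f p) < e / 4" "dist y z < e / 4"
        using n by auto
      then show ?thesis
        unfolding dist_real_def by linarith
    qed
    then have "f p = z"
      by (metis dist_pos_lt less_irrefl)
    moreover have "p \<in> topspace Z"
      using p[of 0] m(1)[of 0] kids(2)[of "h 0"] openin_subset[of Z "fst (m 0)"]
      unfolding child_def by blast
    ultimately show "z \<in> Y"
      using f(3) by blast
  qed
  moreover have "G = Y" if s
  proof -
    have "Y \<subseteq> - V h \<union> W h" if "h \<in> T" for h
      using VW'[OF lT[OF that] \<open>s\<close>] by blast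
    then have "Y \<subseteq> G"
      using V_Nil closure_subset unfolding G_def by blast
    with \<open>G \<subseteq> Y\<close> show ?thesis by blast
  qed
  moreover have "Y \<subseteq> closure G" if "baire_space (top_of_set Y)"
  proof -
    \<comment> \<open>Within \<open>Y\<close> the set \<open>G\<close> is cut out by the
      implications from \<open>V h\<close> to \<open>W h\<close>, one for each node, and
      \<open>VW\<close> is the density that \<open>baire_space_residual\<close> asks for.\<close>
    define \<P> where "\<P> = (\<lambda>h. (V h \<inter> Y, W h \<inter> Y)) ` T"
    have "top_of_set Y closure_of (topspace (top_of_set Y) \<inter>
        (\<Inter>(P, Q)\<in>\<P>. (topspace (top_of_set Y) - P) \<union> Q)) = topspace (top_of_set Y)"
    proof (rule baire_space_residual[OF that])
      show "countable \<P>"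
        using cT by (simp add: \<P>_def)
      fix P Q assume "(P, Q) \<in> \<P>"
      then obtain h where h: "h \<in> T" "P = V h \<inter> Y" "Q = W h \<inter> Y"
        by (auto simp: \<P>_def)
      have "openin (top_of_set Y) P" "openin (top_of_set Y) Q"
        unfolding h using V(1) W by (auto simp: openin_open)
      moreover have "P \<subseteq> top_of_set Y closure_of Q"
        using VW[OF lT[OF h(1)]] by (auto simp: h closure_of_subtopology inf_absorb2)
      ultimately show "openin (top_of_set Y) P \<and> openin (top_of_set Y) Q \<and> P \<subseteq> top_of_set Y closure_of Q"
        by blast
    qed
    moreover have "topspace (top_of_set Y) \<inter> (\<Inter>(P, Q)\<in>\<P>. (topspace (top_of_set Y) - P) \<union> Q) \<subseteq> G"
      using V_Nil closure_subset by (fastforce simp: \<P>_def G_def)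
    ultimately have "Y \<subseteq> top_of_set Y closure_of G"
      by (metis closure_of_mono topspace_euclidean_subtopology)
    then show ?thesis
      using closure_mono[of "Y \<inter> G" G] by (auto simp: closure_of_subtopology)
  qed
  ultimately show thesis
    using that by blast
qed

section \<open>Products of Baire spaces\<close>

text \<open>Conditions are sets of pairs, not boxes: joining two conditions is a union, a coordinate
  may be restricted repeatedly, and over a countable index set with countable bases there are only
  countably many finite conditions.\<close>

definition cylinder :: "('i \<Rightarrow> 'a topology) \<Rightarrow> 'i set \<Rightarrow> ('i \<times> 'a set) set \<Rightarrow> ('i \<Rightarrow> 'a) set" where
  "cylinder X I c = {f \<in> topspace (product_topology X I). \<forall>(i, U)\<in>c. f i \<in> U}"

lemma cylinder_Un: "cylinder X I (c \<union> d) = cylinder X I c \<inter> cylinder X I d"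
proof -
  have "{f \<in> T. A f \<and> B f} = {f \<in> T. A f} \<inter> {f \<in> T. B f}" for T and A B :: "'c \<Rightarrow> bool"
    by blast
  then show ?thesis
    by (simp only: cylinder_def ball_Un)
qed

lemma cylinder_refines:
  assumes "\<And>i U x. \<lbrakk>i \<in> I; openin (X i) U; x \<in> U\<rbrakk> \<Longrightarrow> \<exists>V\<in>\<B> i. x \<in> V \<and> V \<subseteq> U"
    and "openin (product_topology X I) W" "f \<in> W"
  obtains c where "finite c" "c \<subseteq> Sigma I \<B>" "f \<in> cylinder X I c" "cylinder X I c \<subseteq> W"
proof -
  obtain U where U: "finite {i \<in> I. U i \<noteq> topspace (X i)}" "\<And>i. i \<in> I \<Longrightarrow> openin (X i) (U i)"
    "f \<in> Pi\<^sub>E I U" "Pi\<^sub>E I U \<subseteq> W"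
    using assms(2,3) unfolding openin_product_topology_alt by metis
  define J where "J = {i \<in> I. U i \<noteq> topspace (X i)}"
  have "\<exists>V\<in>\<B> i. f i \<in> V \<and> V \<subseteq> U i" if "i \<in> J" for i
  proof (rule assms(1))
    show "i \<in> I" "openin (X i) (U i)" "f i \<in> U i"
      using that U(2,3) by (auto simp: J_def)
  qed
  then obtain V where V: "\<And>i. i \<in> J \<Longrightarrow> V i \<in> \<B> i \<and> f i \<in> V i \<and> V i \<subseteq> U i"
    by metis
  define c where "c = (\<lambda>i. (i, V i)) ` J"
  have "f \<in> topspace (product_topology X I)"
    using assms(2,3) openin_subset by blast
  then have "f \<in> cylinder X I c"
    using V by (auto simp: cylinder_def c_def)
  moreover have "cylinder X I c \<subseteq> Pi\<^sub>E I U"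
  proof
    fix g assume g: "g \<in> cylinder X I c"
    have "g i \<in> U i" if "i \<in> I" for i
    proof (cases "i \<in> J")
      case True
      then show ?thesis
        using g V by (auto simp: cylinder_def c_def)
    next
      case False
      then show ?thesis
        using g that by (auto simp: cylinder_def J_def PiE_iff)
    qed
    then show "g \<in> Pi\<^sub>E I U"
      using g by (auto simp: cylinder_def PiE_iff)
  qed
  moreover have "finite c" "c \<subseteq> Sigma I \<B>"
    using U(1) V by (auto simp: c_def J_def)
  ultimately show thesis
    using that U(4) by blast
qed

lemma openin_cylinder:
  assumes "finite c" "c \<subseteq> Sigma I \<B>" "\<And>i U. \<lbrakk>i \<in> I; U \<in> \<B> i\<rbrakk> \<Longrightarrow> openin (X i) U"
  shows "openin (product_topology X I) (cylinder X I c)"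
  using assms(1,2)
proof (induction c)
  case empty
  have "cylinder X I {} = topspace (product_topology X I)"
    by (auto simp: cylinder_def)
  then show ?case
    by (simp only: openin_topspace)
next
  case (insert p c)
  obtain i U where p: "p = (i, U)" "i \<in> I" "openin (X i) U"
    using insert.prems assms(3) by auto
  have "openin (product_topology X I) {f \<in> topspace (product_topology X I). f i \<in> U}"
    using p by (intro openin_continuous_map_preimage[OF continuous_map_product_projection])
  moreover have "cylinder X I (insert p c) = {f \<in> topspace (product_topology X I). f i \<in> U} \<inter> cylinder X I c"
    by (auto simp: cylinder_def p(1))
  ultimately show ?case
    using insert by auto
qed

lemma second_countable_product:
  assumes "countable I" "\<And>i. i \<in> I \<Longrightarrow> second_countable (X i)"
  shows "second_countable (product_topology X I)"
proof -
  have "\<forall>i\<in>I. \<exists>\<B>. countable \<B> \<and> (\<forall>V\<in>\<B>. openin (X i) V) \<and>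
      (\<forall>U x. openin (X i) U \<and> x \<in> U \<longrightarrow> (\<exists>V\<in>\<B>. x \<in> V \<and> V \<subseteq> U))"
    using assms(2) by (simp add: second_countable_def)
  then obtain \<B> where \<B>: "\<And>i. i \<in> I \<Longrightarrow> countable (\<B> i)" "\<And>i U. \<lbrakk>i \<in> I; U \<in> \<B> i\<rbrakk> \<Longrightarrow> openin (X i) U"
    "\<And>i U x. \<lbrakk>i \<in> I; openin (X i) U; x \<in> U\<rbrakk> \<Longrightarrow> \<exists>V\<in>\<B> i. x \<in> V \<and> V \<subseteq> U"
    by metis
  have "countable (cylinder X I ` {c. finite c \<and> c \<subseteq> Sigma I \<B>})"
    using assms(1) \<B>(1) by (intro countable_image countable_Collect_finite_subset countable_SIGMA)
  moreover have "\<forall>V\<in>cylinder X I ` {c. finite c \<and> c \<subseteq> Sigma I \<B>}. openin (product_topology X I) V"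
    using openin_cylinder[where \<B> = \<B> and X = X and I = I] \<B>(2) by simp
  moreover have "\<exists>V\<in>cylinder X I ` {c. finite c \<and> c \<subseteq> Sigma I \<B>}. f \<in> V \<and> V \<subseteq> W"
    if W: "openin (product_topology X I) W" "f \<in> W" for W f
  proof -
    obtain c where "finite c" "c \<subseteq> Sigma I \<B>" "f \<in> cylinder X I c" "cylinder X I c \<subseteq> W"
      by (rule cylinder_refines[OF \<B>(3) W])
    then show ?thesis
      by blast
  qed
  ultimately show ?thesis
    unfolding second_countable_def by blast
qed

text \<open>Closing off under \<open>e\<close> reduces arbitrary products to countably many coordinates.\<close>

lemma countable_support_closure:
  assumes "countable J0" "J0 \<subseteq> I"
    and "\<And>i. i \<in> I \<Longrightarrow> countable (\<B> i)"
    and "\<And>n c. \<lbrakk>finite c; c \<subseteq> Sigma I \<B>\<rbrakk> \<Longrightarrow> finite (e n c) \<and> e n c \<subseteq> Sigma I \<B>"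
  obtains J where "countable J" "J0 \<subseteq> J" "J \<subseteq> I"
    "\<And>(n::nat) c. \<lbrakk>finite c; c \<subseteq> Sigma J \<B>\<rbrakk> \<Longrightarrow> e n c \<subseteq> Sigma J \<B>"
proof -
  \<comment> \<open>One step adjoins the coordinates of all \<open>e n c\<close> with
    \<open>c\<close> over \<open>J\<close>. After countably many steps a finite condition lives at
    some stage, and its \<open>e n c\<close> at the next.\<close>
  define grow where "grow J = J \<union> (\<Union>n. \<Union>c\<in>{c. finite c \<and> c \<subseteq> Sigma J \<B>}. fst ` e n c)" for J
  define K where "K n = (grow ^^ n) J0" for n
  have K0: "K 0 = J0" and KSuc: "K (Suc n) = grow (K n)" for n
    by (simp_all add: K_def)
  have K: "countable (K n) \<and> K n \<subseteq> I" for n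
  proof (induction n)
    case 0
    then show ?case using assms(1,2) by (simp add: K0)
  next
    case (Suc n)
    define C where "C = {c. finite c \<and> c \<subseteq> Sigma (K n) \<B>}"
    have sub: "Sigma (K n) \<B> \<subseteq> Sigma I \<B>"
      using Suc by blast
    have e: "finite (e k c) \<and> e k c \<subseteq> Sigma I \<B>" if "c \<in> C" for k c
      using that sub by (intro assms(4)) (auto simp: C_def)
    have "countable (\<B> i)" if "i \<in> K n" for i
      using that Suc assms(3) by blast
    then have "countable C"
      using Suc unfolding C_def by (intro countable_Collect_finite_subset countable_SIGMA) auto
    moreover have "countable (fst ` e k c)" if "c \<in> C" for k c
      using e[OF that] by (simp add: countable_finite)
    ultimately have "countable (\<Union>k. \<Union>c\<in>C. fst ` e k c)"
      by simp
    then have "countable (grow (K n))"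
      using Suc by (simp add: grow_def C_def)
    moreover have "fst ` e k c \<subseteq> I" if "c \<in> C" for k c
      using e[OF that] by fastforce
    then have "grow (K n) \<subseteq> I"
      using Suc unfolding grow_def C_def[symmetric] by blast
    ultimately show ?case by (simp add: KSuc)
  qed
  have mono: "K m \<subseteq> K n" if "m \<le> n" for m n
    using that by (induction rule: dec_induct) (auto simp: KSuc grow_def)
  define J where "J = (\<Union>n. K n)"
  have "\<exists>n. c \<subseteq> Sigma (K n) \<B>" if "finite c" "c \<subseteq> Sigma J \<B>" for c
    using that
  proof (induction c)
    case (insert p c)
    then obtain n where "c \<subseteq> Sigma (K n) \<B>" by auto
    moreover obtain m where "fst p \<in> K m"
      using insert.prems by (auto simp: J_def)
    ultimately have "insert p c \<subseteq> Sigma (K (max m n)) \<B>"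
      using insert.prems mono[of m "max m n"] mono[of n "max m n"] by fastforce
    then show ?case by blast
  qed simp
  note fin = this
  have eJ: "e n c \<subseteq> Sigma J \<B>" if c: "finite c" "c \<subseteq> Sigma J \<B>" for n c
  proof -
    obtain k where k: "c \<subseteq> Sigma (K k) \<B>"
      using fin[OF c] by blast
    then have "fst ` e n c \<subseteq> K (Suc k)"
      using c(1) by (auto simp: KSuc grow_def)
    moreover have "J \<subseteq> I"
      using K by (auto simp: J_def)
    then have "c \<subseteq> Sigma I \<B>"
      using c(2) by blast
    then have "e n c \<subseteq> Sigma I \<B>"
      using assms(4) c(1) by simp
    ultimately show ?thesis
      unfolding J_def by force
  qed
  show thesis
  proof (rule that)
    show "countable J" "J0 \<subseteq> J" "J \<subseteq> I"
      using K K0 by (auto simp: J_def)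
  qed (rule eJ)
qed

text \<open>This is Oxtoby's theorem for second countable factors. Once \<open>J\<close> is closed
  under \<open>e\<close>, the density of each \<open>G n\<close> is witnessed by conditions over
  \<open>J\<close>, so the coordinates outside \<open>J\<close> may be copied from \<open>p\<close>.
  Those in \<open>J\<close> are fixed one at a time in the manner of Kuratowski and Ulam: a generic
  value keeps the sections of all \<open>G n\<close> dense.\<close>

theorem baire_space_product:
  fixes X :: "'i \<Rightarrow> 'a topology"
  assumes sc: "\<And>i. i \<in> I \<Longrightarrow> second_countable (X i)"
    and baire: "\<And>i. i \<in> I \<Longrightarrow> baire_space (X i)"
  shows "baire_space (product_topology X I)"
  unfolding baire_space_def
proof (intro allI impI)
  let ?T = "product_topology X I"
  fix \<U> assume \<U>: "countable \<U> \<and> (\<forall>U\<in>\<U>. openin ?T U \<and> ?T closure_of U = topspace ?T)"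
  define G where "G = from_nat_into (insert (topspace ?T) \<U>)"
  have G: "openin ?T (G n) \<and> ?T closure_of (G n) = topspace ?T" for n
    using \<U> from_nat_into[of "insert (topspace ?T) \<U>" n]
    by (metis G_def closure_of_topspace insertE insert_not_empty openin_topspace)
  have range_G: "range G = insert (topspace ?T) \<U>"
    using \<U> by (simp add: G_def)
  have "\<forall>i\<in>I. \<exists>\<B>. countable \<B> \<and> (\<forall>V\<in>\<B>. openin (X i) V) \<and>
      (\<forall>U x. openin (X i) U \<and> x \<in> U \<longrightarrow> (\<exists>V\<in>\<B>. x \<in> V \<and> V \<subseteq> U))"
    using sc by (simp add: second_countable_def)
  then obtain \<B> where \<B>: "\<And>i. i \<in> I \<Longrightarrow> countable (\<B> i)" "\<And>i U. \<lbrakk>i \<in> I; U \<in> \<B> i\<rbrakk> \<Longrightarrow> openin (X i) U"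
    "\<And>i U x. \<lbrakk>i \<in> I; openin (X i) U; x \<in> U\<rbrakk> \<Longrightarrow> \<exists>V\<in>\<B> i. x \<in> V \<and> V \<subseteq> U"
    by metis
  define cyl where "cyl = cylinder X I"
  have cyl_Un: "cyl (c \<union> d) = cyl c \<inter> cyl d" for c d
    by (simp add: cyl_def cylinder_Un)
  have refine: "\<exists>c. finite c \<and> c \<subseteq> Sigma I \<B> \<and> f \<in> cyl c \<and> cyl c \<subseteq> W"
    if W: "openin ?T W" "f \<in> W" for W f
  proof -
    obtain c where "finite c" "c \<subseteq> Sigma I \<B>" "f \<in> cylinder X I c" "cylinder X I c \<subseteq> W"
      by (rule cylinder_refines[OF \<B>(3) W])
    then show ?thesis
      by (auto simp: cyl_def)
  qed
  \<comment> \<open>Vacuous for empty cylinders, so that \<open>e n c\<close> is a finite condition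
    for every finite \<open>c\<close>, as \<open>countable_support_closure\<close> demands.\<close>
  define ext where "ext n c d \<longleftrightarrow> finite d \<and> d \<subseteq> Sigma I \<B> \<and>
      (cyl c \<noteq> {} \<longrightarrow> cyl d \<subseteq> G n \<and> cyl (c \<union> d) \<noteq> {})" for n c d
  have ex_ext: "\<exists>d. ext n c d"
    if c: "finite c" "c \<subseteq> Sigma I \<B>" for n c
  proof (cases "cyl c = {}")
    case False
    have "openin ?T (cyl c)"
      unfolding cyl_def by (rule openin_cylinder[OF c \<B>(2)])
    then obtain f where f: "f \<in> G n" "f \<in> cyl c"
      using False G[of n] unfolding dense_intersects_open by blast
    with refine[of "G n" f] G obtain d where "finite d" "d \<subseteq> Sigma I \<B>" "f \<in> cyl d" "cyl d \<subseteq> G n"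
      by blast
    then show ?thesis
      using f(2) by (intro exI[of _ d]) (auto simp: cyl_Un ext_def)
  qed (auto simp: ext_def)
  define e where "e n c = (SOME d. ext n c d)" for n c
  have e: "finite (e n c) \<and> e n c \<subseteq> Sigma I \<B>"
    "cyl c \<noteq> {} \<Longrightarrow> cyl (e n c) \<subseteq> G n \<and> cyl (c \<union> e n c) \<noteq> {}"
    if "finite c" "c \<subseteq> Sigma I \<B>" for n c
  proof -
    have "ext n c (e n c)"
      unfolding e_def by (rule someI_ex[OF ex_ext[OF that]])
    then show "finite (e n c) \<and> e n c \<subseteq> Sigma I \<B>"
      "cyl c \<noteq> {} \<Longrightarrow> cyl (e n c) \<subseteq> G n \<and> cyl (c \<union> e n c) \<noteq> {}"
      unfolding ext_def by blast+
  qed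
  show "?T closure_of (topspace ?T \<inter> \<Inter>\<U>) = topspace ?T"
    unfolding dense_intersects_open
  proof (intro allI impI)
    fix W assume W: "openin ?T W \<and> W \<noteq> {}"
    then obtain p where p: "p \<in> W" "p \<in> topspace ?T"
      using openin_subset[of ?T W] by blast
    obtain c0 where c0: "finite c0" "c0 \<subseteq> Sigma I \<B>" "p \<in> cyl c0" "cyl c0 \<subseteq> W"
      using refine[of W p] W p(1) by blast
    have J0: "countable (fst ` c0)" "fst ` c0 \<subseteq> I"
      using c0 by (auto simp: countable_finite)
    obtain J where J: "countable J" "fst ` c0 \<subseteq> J" "J \<subseteq> I"
      "\<And>n c. \<lbrakk>finite c; c \<subseteq> Sigma J \<B>\<rbrakk> \<Longrightarrow> e n c \<subseteq> Sigma J \<B>"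
      by (rule countable_support_closure[where e = e, OF J0 \<B>(1) e(1)]) (assumption | rule that)+
    define C where "C = {c. finite c \<and> c \<subseteq> Sigma J \<B>}"
    have "c0 \<in> C"
      using c0 J(2) by (force simp: C_def)
    have C_Un: "c \<union> d \<in> C" if "c \<in> C" "d \<in> C" for c d
      using that by (auto simp: C_def)
    have "countable (\<B> i)" if "i \<in> J" for i
      using that J(3) \<B>(1) by blast
    then have "countable C"
      using J(1) unfolding C_def by (intro countable_Collect_finite_subset countable_SIGMA) auto
    define D where "D n = {d \<in> C. cyl d \<subseteq> G n}" for n
    define agree where "agree F a = {f \<in> topspace ?T. \<forall>i\<in>F. f i = a i}" for F a
    \<comment> \<open>Over \<open>J\<close>, the sections at \<open>a\<close> of all sets \<open>G n\<close> are still dense.\<close>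
    define good where "good F a \<longleftrightarrow> (\<forall>n. \<forall>c\<in>C. cyl c \<inter> agree F a \<noteq> {} \<longrightarrow>
        (\<exists>d\<in>D n. cyl (c \<union> d) \<inter> agree F a \<noteq> {}))" for F a
    \<comment> \<open>This is where the closure of \<open>J\<close> under \<open>e\<close> enters:
      \<open>e n c\<close> is again a condition over \<open>J\<close>.\<close>
    have good_empty: "good {} p"
      unfolding good_def
    proof (intro allI ballI impI)
      fix n c assume c: "c \<in> C" and "cyl c \<inter> agree {} p \<noteq> {}"
      then have "finite c" "c \<subseteq> Sigma J \<B>" "c \<subseteq> Sigma I \<B>" "cyl c \<noteq> {}"
        using J(3) by (auto simp: C_def)
      then have "e n c \<in> D n" "cyl (c \<union> e n c) \<noteq> {}"
        using e[of c] J(4)[of c] by (simp_all add: D_def C_def)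
      moreover have "cyl c' \<subseteq> agree {} p" for c'
        by (auto simp: agree_def cyl_def cylinder_def)
      ultimately show "\<exists>d\<in>D n. cyl (c \<union> d) \<inter> agree {} p \<noteq> {}"
        by blast
    qed
    \<comment> \<open>With \<open>P c\<close> the values at \<open>j\<close> that occur in the
      section of \<open>cyl c\<close>, goodness of the extended assignment says that
      \<open>y \<in> P c\<close> implies \<open>y \<in> Q n c\<close> for all \<open>n\<close> and
      \<open>c \<in> C\<close>. These are countably many pairs for
      \<open>baire_space_residual\<close> in the factor \<open>X j\<close>.\<close>
    have step: "\<exists>y. good (insert j F) (a(j := y)) \<and> cyl c \<inter> agree (insert j F) (a(j := y)) \<noteq> {}"
      if "j \<in> J" "j \<notin> F" "good F a" "c \<in> C" "cyl c \<inter> agree F a \<noteq> {}" for j F a c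
    proof -
      define P where "P c = (\<lambda>f. f j) ` (cyl c \<inter> agree F a)" for c
      have agree_insert: "agree (insert j F) (a(j := y)) = {f \<in> agree F a. f j = y}" for y
        using that(2) by (auto simp: agree_def)
      have P_iff: "cyl c \<inter> agree (insert j F) (a(j := y)) \<noteq> {} \<longleftrightarrow> y \<in> P c" for c y
        by (auto simp: agree_insert P_def)
      have j: "j \<in> I"
        using that(1) J(3) by blast
      \<comment> \<open>From one point of the section, coordinate \<open>j\<close> can be changed
        freely within the finitely many sets that \<open>c\<close> prescribes there, since
        \<open>j\<close> is not yet fixed.\<close>
      have P_open: "openin (X j) (P c)" if "c \<in> C" for c
      proof (cases "cyl c \<inter> agree F a = {}")
        case False
        then obtain f where f: "f \<in> cyl c" "f \<in> agree F a"
          by blast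
        define \<F> where "\<F> = insert (topspace (X j)) (snd ` {q \<in> c. fst q = j})"
        have "openin (X j) (\<Inter>\<F>)"
          using \<open>c \<in> C\<close> \<B>(2) j by (intro openin_Inter) (auto simp: \<F>_def C_def)
        moreover have "P c = \<Inter>\<F>"
        proof
          show "P c \<subseteq> \<Inter>\<F>"
            using j by (fastforce simp: P_def \<F>_def cyl_def cylinder_def)
          show "\<Inter>\<F> \<subseteq> P c"
          proof
            fix y assume y: "y \<in> \<Inter>\<F>"
            have "f(j := y) \<in> cyl c"
              using f(1) y j by (fastforce simp: \<F>_def cyl_def cylinder_def PiE_iff extensional_def)
            moreover have "f(j := y) \<in> agree F a"
              using f(2) y j \<open>j \<notin> F\<close> by (auto simp: \<F>_def agree_def PiE_iff extensional_def)
            ultimately show "y \<in> P c"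
              unfolding P_def by (intro image_eqI[of _ _ "f(j := y)"]) auto
          qed
        qed
        ultimately show ?thesis
          by simp
      qed (simp add: P_def)
      define Q where "Q n c = (\<Union>d\<in>D n. P (c \<union> d))" for n c
      have Q_open: "openin (X j) (Q n c)" if "c \<in> C" for n c
        unfolding Q_def using P_open C_Un that by (intro openin_Union) (auto simp: D_def)
      \<comment> \<open>Nearness to \<open>y\<close> is itself a condition: adding
        \<open>(j, V')\<close> to \<open>c\<close> and applying goodness of \<open>F\<close> and
        \<open>a\<close> yields a value in \<open>Q n c\<close> close to \<open>y\<close>.\<close>
      have PQ: "P c \<subseteq> X j closure_of (Q n c)" if "c \<in> C" for n c
      proof
        fix y assume "y \<in> P c"
        then obtain f where f: "f \<in> cyl c" "f \<in> agree F a" "y = f j"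
          by (auto simp: P_def)
        have "\<exists>z\<in>Q n c. z \<in> V" if V: "y \<in> V" "openin (X j) V" for V
        proof -
          obtain V' where V': "V' \<in> \<B> j" "y \<in> V'" "V' \<subseteq> V"
            using \<B>(3)[OF j V(2,1)] by blast
          define c' where "c' = insert (j, V') c"
          have "c' \<in> C"
            using \<open>c \<in> C\<close> V'(1) \<open>j \<in> J\<close> by (auto simp: C_def c'_def)
          moreover have "f \<in> cyl c'"
            using f V'(2) by (auto simp: c'_def cyl_def cylinder_def)
          ultimately obtain d g where "d \<in> D n" "g \<in> cyl (c' \<union> d)" "g \<in> agree F a"
            using \<open>good F a\<close> f(2) unfolding good_def by blast
          moreover from this have "g \<in> cyl (c \<union> d)" "g j \<in> V'"
            by (auto simp: c'_def cyl_def cylinder_def)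
          ultimately show ?thesis
            using V'(3) unfolding Q_def P_def by blast
        qed
        moreover have "y \<in> topspace (X j)"
          using f(2,3) j by (auto simp: agree_def)
        ultimately show "y \<in> X j closure_of (Q n c)"
          unfolding in_closure_of by blast
      qed
      define \<P> where "\<P> = (\<lambda>(n, c). (P c, Q n c)) ` ((UNIV :: nat set) \<times> C)"
      have "X j closure_of (topspace (X j) \<inter> (\<Inter>(P, Q)\<in>\<P>. (topspace (X j) - P) \<union> Q)) = topspace (X j)"
      proof (rule baire_space_residual[OF baire[OF j]])
        show "countable \<P>"
          using \<open>countable C\<close> by (simp add: \<P>_def)
        fix P' Q' assume "(P', Q') \<in> \<P>"
        then obtain n c where "c \<in> C" "P' = P c" "Q' = Q n c"
          by (auto simp: \<P>_def)
        then show "openin (X j) P' \<and> openin (X j) Q' \<and> P' \<subseteq> X j closure_of Q'"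
          using P_open Q_open PQ by simp
      qed
      moreover have "openin (X j) (P c)" "P c \<noteq> {}"
        using P_open that(4,5) by (auto simp: P_def)
      ultimately obtain y where y: "y \<in> P c" "y \<in> (\<Inter>(P, Q)\<in>\<P>. (topspace (X j) - P) \<union> Q)"
        unfolding dense_intersects_open by blast
      have yQ: "y \<in> Q n c'" if "c' \<in> C" "y \<in> P c'" for n c'
        using y(2) that by (auto simp: \<P>_def)
      have "good (insert j F) (a(j := y))"
        unfolding good_def P_iff
      proof (intro allI ballI impI)
        fix n c' assume "c' \<in> C" "y \<in> P c'"
        then show "\<exists>d\<in>D n. y \<in> P (c' \<union> d)"
          using yQ[of c' n] by (simp add: Q_def)
      qed
      then show ?thesis
        using P_iff y(1) by blast
    qed
    define S where "S n s \<longleftrightarrow> (case s of (F, a, c) \<Rightarrow>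
        F \<subseteq> J \<and> good F a \<and> c \<in> C \<and> c0 \<subseteq> c \<and> cyl c \<inter> agree F a \<noteq> {})" for n :: nat and s
    \<comment> \<open>Stage \<open>n\<close> sees to the coordinate numbered \<open>n\<close> and
      puts the cylinder into \<open>G n\<close>. The guard is for empty \<open>J\<close>, where the
      enumeration returns an arbitrary value.\<close>
    define R where "R n s s' \<longleftrightarrow> (case s of (F, a, c) \<Rightarrow> case s' of (F', a', c') \<Rightarrow>
        F \<subseteq> F' \<and> c \<subseteq> c' \<and> (\<forall>i\<in>F. a' i = a i) \<and> (from_nat_into J n \<in> J \<longrightarrow> from_nat_into J n \<in> F') \<and>
        (\<exists>d\<in>D n. d \<subseteq> c'))"
      for n and s s' :: "'i set \<times> ('i \<Rightarrow> 'a) \<times> ('i \<times> 'a set) set"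
    have "\<exists>s. S 0 s"
      using good_empty \<open>c0 \<in> C\<close> c0(3) p(2) by (intro exI[of _ "({}, p, c0)"]) (auto simp: S_def agree_def)
    moreover have "\<exists>s'. S (Suc n) s' \<and> R n s s'" if "S n s" for n s
    proof -
      obtain F a c where s: "s = (F, a, c)" by (cases s)
      have F: "F \<subseteq> J" "good F a" "c \<in> C" "c0 \<subseteq> c" "cyl c \<inter> agree F a \<noteq> {}"
        using that by (auto simp: S_def s)
      then obtain d where d: "d \<in> D n" "cyl (c \<union> d) \<inter> agree F a \<noteq> {}"
        unfolding good_def by blast
      define j where "j = from_nat_into J n"
      have cd: "c \<union> d \<in> C" "c0 \<subseteq> c \<union> d"
        using C_Un F d(1) by (auto simp: D_def)
      show ?thesis
      proof (cases "j \<in> J \<and> j \<notin> F")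
        case True
        then obtain y where "good (insert j F) (a(j := y))"
          "cyl (c \<union> d) \<inter> agree (insert j F) (a(j := y)) \<noteq> {}"
          using step F(2) cd(1) d(2) by blast
        then show ?thesis
          using True cd d(1) F(1) by (intro exI[of _ "(insert j F, a(j := y), c \<union> d)"])
            (auto simp: S_def R_def s j_def[symmetric])
      next
        case False
        then show ?thesis
          using cd d F(1,2) by (intro exI[of _ "(F, a, c \<union> d)"]) (auto simp: S_def R_def s j_def[symmetric])
      qed
    qed
    ultimately obtain s where s: "\<And>n. S n (s n)" "\<And>n. R n (s n) (s (Suc n))"
      using dependent_nat_choice[of S R] by blast
    define F where "F n = fst (s n)" for n
    define a where "a n = fst (snd (s n))" for n
    define c where "c n = snd (snd (s n))" for n
    have S: "F n \<subseteq> J" "c n \<in> C" "c0 \<subseteq> c n" "cyl (c n) \<inter> agree (F n) (a n) \<noteq> {}" for n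
      using s(1)[of n] by (auto simp: S_def F_def a_def c_def split: prod.splits)
    have R: "F n \<subseteq> F (Suc n)" "c n \<subseteq> c (Suc n)" "\<And>i. i \<in> F n \<Longrightarrow> a (Suc n) i = a n i"
      "from_nat_into J n \<in> J \<Longrightarrow> from_nat_into J n \<in> F (Suc n)" "\<exists>d\<in>D n. d \<subseteq> c (Suc n)" for n
      using s(2)[of n] by (auto simp: R_def F_def a_def c_def split: prod.splits)
    have mono: "F m \<subseteq> F n \<and> c m \<subseteq> c n \<and> (\<forall>i\<in>F m. a n i = a m i)" if "m \<le> n" for m n
      using that
    proof (induction rule: dec_induct)
      case (step n)
      then show ?case
        using R(1,2)[of n] R(3)[of _ n] by (metis subset_iff)
    qed simp
    have "\<exists>m. j \<in> F m" if j: "j \<in> J" for j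
    proof -
      obtain n where "from_nat_into J n = j"
        using from_nat_into_surj[OF J(1) j] by blast
      then show ?thesis
        using R(4)[of n] j by blast
    qed
    then obtain k where k: "\<And>j. j \<in> J \<Longrightarrow> j \<in> F (k j)"
      by metis
    \<comment> \<open>\<open>k i\<close> is a stage at which \<open>i\<close> is already fixed;
      later stages do not change the value. Conditions in \<open>C\<close> say nothing outside
      \<open>J\<close>, where \<open>p\<close> serves.\<close>
    define f where "f = restrict (\<lambda>i. if i \<in> J then a (k i) i else p i) I"
    have f_J: "f i = a n i" if "i \<in> J" "k i \<le> n" for i n
      using that mono[of "k i" n] k J(3) by (auto simp: f_def)
    have f_cyl: "f \<in> cyl (c n)" for n
    proof -
      have "f i \<in> topspace (X i)" if i: "i \<in> I" for i
      proof (cases "i \<in> J")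
        case True
        obtain g where "g \<in> agree (F (k i)) (a (k i))"
          using S(4) by blast
        then have "g i = f i" "g i \<in> topspace (X i)"
          using f_J[OF True, of "k i"] k[OF True] i PiE_mem[of g I "\<lambda>i. topspace (X i)" i]
          by (simp_all add: agree_def)
        then show ?thesis by simp
      qed (use i p(2) in \<open>auto simp: f_def\<close>)
      then have "f \<in> topspace ?T"
        by (auto simp: f_def)
      moreover have "f i \<in> U" if iU: "(i, U) \<in> c n" for i U
      proof -
        have i: "i \<in> J"
          using iU S(2)[of n] by (auto simp: C_def)
        \<comment> \<open>At this stage \<open>(i, U)\<close> is among the conditions and
          \<open>i\<close> is fixed, so any point of the non-empty section has at \<open>i\<close>
          the value of \<open>f\<close>, and that value lies in \<open>U\<close>.\<close>
        define m where "m = max n (k i)"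
        obtain g where g: "g \<in> cyl (c m)" "g \<in> agree (F m) (a m)"
          using S(4) by blast
        have "(i, U) \<in> c m" "i \<in> F m"
          using mono[of n m] mono[of "k i" m] iU k[OF i] by (auto simp: m_def)
        then have "g i \<in> U" "g i = a m i"
          using g by (auto simp: agree_def cyl_def cylinder_def)
        then show ?thesis
          using f_J[OF i, of m] by (simp add: m_def)
      qed
      ultimately show ?thesis
        by (auto simp: cyl_def cylinder_def)
    qed
    have anti: "cyl c \<subseteq> cyl d" if "d \<subseteq> c" for c d
      using that by (auto simp: cyl_def cylinder_def)
    have "f \<in> W"
      using f_cyl[of 0] anti[OF S(3)[of 0]] c0(4) by blast
    moreover have "f \<in> G n" for n
    proof -
      obtain d where "d \<in> D n" "d \<subseteq> c (Suc n)"
        using R(5)[of n] by blast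
      then show ?thesis
        using f_cyl[of "Suc n"] anti[of d "c (Suc n)"] by (auto simp: D_def)
    qed
    then have "f \<in> \<Inter>(insert (topspace ?T) \<U>)"
      unfolding range_G[symmetric] by blast
    ultimately show "topspace ?T \<inter> \<Inter>\<U> \<inter> W \<noteq> {}"
      by auto
  qed
qed

section \<open>The Fell hypograph topology\<close>

lemma closedin_hypograph_function:
  assumes "f \<in> continuous_functions X Y"
  shows "closedin (prod_topology X euclideanreal) (hypograph X f)"
  using assms by (intro closedin_hypograph) (auto simp: continuous_functions_def continuous_map_in_subtopology)

lemma openin_fell_hypograph:
  assumes "openin (fell_topology (prod_topology X euclideanreal)) S"
  shows "openin (fell_hypograph_topology X Y) {f \<in> continuous_functions X Y. hypograph X f \<in> S}"
proof -
  have "{f \<in> continuous_functions X Y. hypograph X f \<in> S} = hypograph X -` S \<inter> continuous_functions X Y"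
    by blast
  then show ?thesis
    unfolding fell_hypograph_topology_def openin_pullback_topology using assms by blast
qed

lemma fell_hypograph_hit_open:
  assumes "openin X U"
  shows "openin (fell_hypograph_topology X Y) {f \<in> continuous_functions X Y. \<exists>x\<in>U. f x > a}"
proof -
  let ?P = "prod_topology X euclideanreal"
  let ?S = "{F. closedin ?P F \<and> F \<inter> (U \<times> {a<..}) \<noteq> {}}"
  have "openin ?P (U \<times> {a<..})"
    using assms by (simp add: openin_prod_Times_iff)
  then have "openin (fell_topology ?P) ?S"
    unfolding fell_topology_def by (intro topology_generated_by_Basis UnI1) blast
  moreover have "hypograph X f \<in> ?S \<longleftrightarrow> (\<exists>x\<in>U. f x > a)" if "f \<in> continuous_functions X Y" for f
    using closedin_hypograph_function[OF that] openin_subset[OF assms]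
    by (fastforce simp: hypograph_def)
  ultimately show ?thesis
    using openin_fell_hypograph[of X ?S Y] by (simp cong: conj_cong)
qed

lemma fell_hypograph_miss_point:
  assumes "x \<in> topspace X"
  shows "openin (fell_hypograph_topology X Y) {f \<in> continuous_functions X Y. f x < a}"
proof -
  let ?P = "prod_topology X euclideanreal"
  let ?S = "{F. closedin ?P F \<and> F \<subseteq> topspace ?P - {(x, a)}}"
  have "compactin ?P {(x, a)}"
    using assms by simp
  then have "openin (fell_topology ?P) ?S"
    unfolding fell_topology_def by (intro topology_generated_by_Basis UnI2) blast
  moreover have "hypograph X f \<in> ?S \<longleftrightarrow> f x < a" if "f \<in> continuous_functions X Y" for f
  proof -
    have "hypograph X f \<in> ?S \<longleftrightarrow> (x, a) \<notin> hypograph X f"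
      using closedin_hypograph_function[OF that] closedin_subset by blast
    then show ?thesis
      using assms by (auto simp: hypograph_def)
  qed
  ultimately show ?thesis
    using openin_fell_hypograph[of X ?S Y] by (simp cong: conj_cong)
qed

section \<open>Discrete domains\<close>

lemma discrete_spaceD: "discrete_space X \<Longrightarrow> x \<in> topspace X \<Longrightarrow> openin X {x}"
  by (metis discrete_space_def discrete_topology_unique)

lemma continuous_functions_discrete:
  assumes "discrete_space X"
  shows "continuous_functions X Y = (\<Pi>\<^sub>E x\<in>topspace X. Y)"
proof -
  have "continuous_map X (top_of_set Y) f \<longleftrightarrow> f \<in> topspace X \<rightarrow> Y" for f
    using assms unfolding discrete_space_def by (metis continuous_map_from_discrete_topology topspace_euclidean_subtopology)
  then show ?thesis
    by (auto simp: continuous_functions_def PiE_def)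
qed

text \<open>\<open>K\<close> projects to a compact, hence finite, subset of \<open>X\<close>, and
  each vertical slice of \<open>K\<close> is compact. So missing \<open>K\<close> means staying
  below the minimum of the slice at finitely many points.\<close>

lemma compactin_miss_open_product:
  assumes X: "discrete_space X" and K: "compactin (prod_topology X euclideanreal) K"
  shows "openin (product_topology (\<lambda>_. top_of_set Y) (topspace X))
      {f \<in> (\<Pi>\<^sub>E x\<in>topspace X. Y). hypograph X f \<inter> K = {}}"
proof -
  let ?T = "product_topology (\<lambda>_. top_of_set Y) (topspace X)"
  have "compactin X (fst ` K)"
    by (rule image_compactin[OF K continuous_map_fst])
  then have fin: "finite (fst ` K)" "fst ` K \<subseteq> topspace X"
    using X unfolding discrete_space_def by (metis compactin_discrete_topology)+
  define S where "S x = {t \<in> Y. \<forall>y. (x, y) \<in> K \<longrightarrow> t < y}" for x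
  have S: "openin (top_of_set Y) (S x)" if "x \<in> fst ` K" for x
  proof -
    have "closedin X (topspace X - (topspace X - {x}))"
      using discrete_spaceD[OF X] that fin(2) openin_Union[of "(\<lambda>z. {z}) ` (topspace X - {x})" X]
      by (intro closedin_diff) auto
    moreover have "x \<in> topspace X"
      using that fin(2) by blast
    ultimately have "closedin X {x}"
      by (simp add: double_diff)
    then have "closedin (prod_topology X euclideanreal) ({x} \<times> UNIV)"
      by (simp add: closedin_prod_Times_iff)
    then have "compactin (prod_topology X euclideanreal) (K \<inter> {x} \<times> UNIV)"
      using K compact_Int_closedin by blast
    then have "compactin euclideanreal (snd ` (K \<inter> {x} \<times> UNIV))"
      by (rule image_compactin) (rule continuous_map_snd)
    moreover have "snd ` (K \<inter> {x} \<times> UNIV) \<noteq> {}"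
      using that by force
    ultimately obtain m where "m \<in> snd ` (K \<inter> {x} \<times> UNIV)" "\<forall>y\<in>snd ` (K \<inter> {x} \<times> UNIV). m \<le> y"
      using compact_attains_inf[of "snd ` (K \<inter> {x} \<times> UNIV)"] by auto
    then have "S x = Y \<inter> {..<m}"
      by (force simp: S_def)
    then show ?thesis
      by (simp add: openin_open_Int)
  qed
  have "openin ?T {f \<in> topspace ?T. f x \<in> S x}" if "x \<in> fst ` K" for x
    using that fin(2) S by (intro openin_continuous_map_preimage[OF continuous_map_product_projection]) auto
  then have "openin ?T ((\<Inter>x\<in>fst ` K. {f \<in> topspace ?T. f x \<in> S x}) \<inter> topspace ?T)"
    by (rule openin_INT[OF fin(1)])
  moreover have "(\<Inter>x\<in>fst ` K. {f \<in> topspace ?T. f x \<in> S x}) \<inter> topspace ?T =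
      {f \<in> (\<Pi>\<^sub>E x\<in>topspace X. Y). hypograph X f \<inter> K = {}}"
  proof (intro equalityI subsetI)
    fix f assume f: "f \<in> (\<Inter>x\<in>fst ` K. {f \<in> topspace ?T. f x \<in> S x}) \<inter> topspace ?T"
    have "\<not> y \<le> f x" if "(x, y) \<in> K" for x y
    proof -
      have "x \<in> fst ` K"
        using that by force
      then have "f x \<in> S x"
        using f by blast
      then show ?thesis
        using that by (auto simp: S_def)
    qed
    then show "f \<in> {f \<in> (\<Pi>\<^sub>E x\<in>topspace X. Y). hypograph X f \<inter> K = {}}"
      using f by (auto simp: hypograph_def)
  next
    fix f assume f: "f \<in> {f \<in> (\<Pi>\<^sub>E x\<in>topspace X. Y). hypograph X f \<inter> K = {}}"
    have "f x \<in> S x" if "x \<in> fst ` K" for x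
    proof -
      have "x \<in> topspace X"
        using that fin(2) by blast
      moreover from this have "f x \<in> Y"
        using f by auto
      moreover have "f x < y" if "(x, y) \<in> K" for y
      proof -
        have "(x, y) \<notin> hypograph X f"
          using that f by blast
        then show ?thesis
          using \<open>x \<in> topspace X\<close> by (auto simp: hypograph_def)
      qed
      ultimately show ?thesis
        by (simp add: S_def)
    qed
    then show "f \<in> (\<Inter>x\<in>fst ` K. {f \<in> topspace ?T. f x \<in> S x}) \<inter> topspace ?T"
      using f by simp
  qed
  ultimately show ?thesis
    by simp
qed

text \<open>Moving down inside \<open>U\<close> turns the non-strict \<open>y \<le> f x\<close> of a
  hypograph into the strict \<open>z < f x\<close>, which is an open condition on
  \<open>f\<close>.\<close>

lemma openin_prod_topology_real_below:
  assumes "openin (prod_topology X euclideanreal) U" "(x, y) \<in> U"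
  obtains A z where "openin X A" "x \<in> A" "z < y" "A \<times> {z} \<subseteq> U"
proof -
  obtain A B where AB: "openin X A" "open B" "x \<in> A" "y \<in> B" "A \<times> B \<subseteq> U"
    using assms unfolding openin_prod_topology_alt by (metis open_openin)
  then obtain e where "e > 0" "ball y e \<subseteq> B"
    by (auto simp: open_contains_ball)
  then have "y - e / 2 \<in> B"
    by (auto simp: dist_real_def)
  then show thesis
    using that[of A "y - e / 2"] AB \<open>e > 0\<close> by auto
qed

text \<open>At an isolated point \<open>f x > a\<close> is a hit condition, and
  \<open>f x < a\<close> is always the miss of \<open>(x, a)\<close>; so the coordinates are
  continuous. Conversely, a hit is a union of strict lower bounds at single points, and a miss
  involves only finitely many points.\<close>

lemma fell_hypograph_topology_discrete:
  assumes "discrete_space X"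
  shows "fell_hypograph_topology X Y = product_topology (\<lambda>_. top_of_set Y) (topspace X)"
proof -
  let ?F = "fell_hypograph_topology X Y" and ?T = "product_topology (\<lambda>_. top_of_set Y) (topspace X)"
  let ?P = "prod_topology X euclideanreal"
  note cf = continuous_functions_discrete[OF assms]
  have top: "topspace ?F = topspace ?T"
    by (simp add: topspace_fell_hypograph_topology cf)
  have "continuous_map ?F ?T id"
    unfolding continuous_map_componentwise
  proof (intro conjI ballI)
    show "id ` topspace ?F \<subseteq> extensional (topspace X)"
      by (auto simp: topspace_fell_hypograph_topology continuous_functions_def)
    fix x assume x: "x \<in> topspace X"
    have "openin ?F {f \<in> topspace ?F. f x > a}" for a
      using fell_hypograph_hit_open[OF discrete_spaceD[OF assms x], of Y a]
      by (simp add: topspace_fell_hypograph_topology)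
    moreover have "openin ?F {f \<in> topspace ?F. f x < a}" for a
      using fell_hypograph_miss_point[OF x, of Y a] by (simp add: topspace_fell_hypograph_topology)
    moreover have "f x \<in> Y" if "f \<in> topspace ?F" for f
      using that x by (auto simp: topspace_fell_hypograph_topology cf)
    ultimately show "continuous_map ?F (top_of_set Y) (\<lambda>f. id f x)"
      unfolding continuous_map_upper_lower_semicontinuous_lt_gen by simp
  qed
  moreover have "continuous_map ?T ?F id"
    unfolding fell_hypograph_topology_def
  proof (rule continuous_map_pullback')
    show "topspace ?T \<subseteq> id -` continuous_functions X Y"
      by (simp add: cf)
    show "continuous_map ?T (fell_topology ?P) (hypograph X \<circ> id)"
      unfolding fell_topology_def
    proof (rule continuous_on_generated_topo)
      have clo: "closedin ?P (hypograph X f)" if "f \<in> topspace ?T" for f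
        using that cf[of Y] by (intro closedin_hypograph_function[where Y = Y]) simp
      show "(hypograph X \<circ> id) ` topspace ?T \<subseteq>
          \<Union>({{F. closedin ?P F \<and> F \<inter> U \<noteq> {}} |U. openin ?P U} \<union>
            {{F. closedin ?P F \<and> F \<subseteq> topspace ?P - K} |K. compactin ?P K})"
        using topspace_fell_topology[of ?P] clo unfolding fell_topology_def topology_generated_by_topspace by auto
      fix S assume "S \<in> {{F. closedin ?P F \<and> F \<inter> U \<noteq> {}} |U. openin ?P U} \<union>
            {{F. closedin ?P F \<and> F \<subseteq> topspace ?P - K} |K. compactin ?P K}"
      then consider (hit) U where "openin ?P U" "S = {F. closedin ?P F \<and> F \<inter> U \<noteq> {}}"
        | (miss) K where "compactin ?P K" "S = {F. closedin ?P F \<and> F \<subseteq> topspace ?P - K}"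
        by blast
      then show "openin ?T ((hypograph X \<circ> id) -` S \<inter> topspace ?T)"
      proof cases
        case hit
        have U: "U \<subseteq> topspace X \<times> UNIV"
          using openin_subset[OF hit(1)] by simp
        have "openin ?T {f \<in> topspace ?T. f x \<in> Y \<inter> {y<..}}" if "x \<in> topspace X" for x y
          using that by (intro openin_continuous_map_preimage[OF continuous_map_product_projection])
            (auto intro: openin_open_Int)
        then have "openin ?T (\<Union>p\<in>U. {f \<in> topspace ?T. f (fst p) \<in> Y \<inter> {snd p<..}})"
          using U by (intro openin_Union) auto
        moreover have "(hypograph X \<circ> id) -` S \<inter> topspace ?T =
            (\<Union>p\<in>U. {f \<in> topspace ?T. f (fst p) \<in> Y \<inter> {snd p<..}})"
        proof (intro equalityI subsetI)
          fix f assume f: "f \<in> (hypograph X \<circ> id) -` S \<inter> topspace ?T"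
          then obtain x y where xy: "(x, y) \<in> U" "y \<le> f x"
            by (auto simp: hit(2) hypograph_def)
          then obtain A z where "x \<in> A" "z < y" "A \<times> {z} \<subseteq> U"
            using openin_prod_topology_real_below[OF hit(1)] by metis
          then have "(x, z) \<in> U" "z < f x" "f x \<in> Y"
            using xy f U by (auto simp: PiE_iff)
          then show "f \<in> (\<Union>p\<in>U. {f \<in> topspace ?T. f (fst p) \<in> Y \<inter> {snd p<..}})"
            using f by (intro UN_I[of "(x, z)"]) auto
        next
          fix f assume f: "f \<in> (\<Union>p\<in>U. {f \<in> topspace ?T. f (fst p) \<in> Y \<inter> {snd p<..}})"
          then obtain x y where xy: "(x, y) \<in> U" "y < f x" "f \<in> topspace ?T"
            by auto
          then have "(x, y) \<in> hypograph X f \<inter> U"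
            using U by (auto simp: hypograph_def)
          then show "f \<in> (hypograph X \<circ> id) -` S \<inter> topspace ?T"
            using clo[OF xy(3)] xy(3) by (auto simp: hit(2))
        qed
        ultimately show ?thesis
          by simp
      next
        case miss
        have "(hypograph X \<circ> id) -` S \<inter> topspace ?T = {f \<in> (\<Pi>\<^sub>E x\<in>topspace X. Y). hypograph X f \<inter> K = {}}"
          using clo by (auto simp: miss(2) hypograph_def)
        then show ?thesis
          using compactin_miss_open_product[OF assms miss(1)] by simp
      qed
    qed
  qed
  ultimately have FT: "continuous_map ?F ?T id" and TF: "continuous_map ?T ?F id"
    by auto
  have "openin ?F S \<longleftrightarrow> openin ?T S" for S
  proof
    assume S: "openin ?F S"
    then have "{f \<in> topspace ?T. id f \<in> S} = S"
      using openin_subset[OF S] top by auto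
    then show "openin ?T S"
      using openin_continuous_map_preimage[OF TF S] by simp
  next
    assume S: "openin ?T S"
    then have "{f \<in> topspace ?F. id f \<in> S} = S"
      using openin_subset[OF S] top by auto
    then show "openin ?F S"
      using openin_continuous_map_preimage[OF FT S] by simp
  qed
  then show ?thesis
    unfolding topology_eq by blast
qed

section \<open>Non-isolated points of the domain\<close>

lemma openin_fell_topology_lowering:
  assumes "openin (fell_topology (prod_topology X euclideanreal)) S"
    and f: "f \<in> continuous_functions X Y" and "hypograph X f \<in> S"
    and x0: "x0 \<in> topspace X" "\<not> openin X {x0}"
  shows "\<exists>A. finite A \<and> A \<subseteq> topspace X - {x0} \<and>
    (\<forall>g\<in>continuous_functions X Y. (\<forall>x\<in>topspace X. g x \<le> f x) \<and> (\<forall>x\<in>A. g x = f x) \<longrightarrow> hypograph X g \<in> S)"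
proof -
  let ?P = "prod_topology X euclideanreal"
  note clo = closedin_hypograph_function
  have "generate_topology_on ({{F. closedin ?P F \<and> F \<inter> U \<noteq> {}} |U. openin ?P U} \<union>
      {{F. closedin ?P F \<and> F \<subseteq> topspace ?P - K} |K. compactin ?P K}) S"
    using assms(1) unfolding fell_topology_def by (rule openin_topology_generated_by)
  then show ?thesis
    using assms(3)
  proof (induction rule: generate_topology_on.induct)
    case Empty
    then show ?case by simp
  next
    case (Int a b)
    then obtain A B where "finite A" "A \<subseteq> topspace X - {x0}" "finite B" "B \<subseteq> topspace X - {x0}"
      "\<forall>g\<in>continuous_functions X Y. (\<forall>x\<in>topspace X. g x \<le> f x) \<and> (\<forall>x\<in>A. g x = f x) \<longrightarrow> hypograph X g \<in> a"
      "\<forall>g\<in>continuous_functions X Y. (\<forall>x\<in>topspace X. g x \<le> f x) \<and> (\<forall>x\<in>B. g x = f x) \<longrightarrow> hypograph X g \<in> b"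
      by auto
    then show ?case
      by (intro exI[of _ "A \<union> B"]) auto
  next
    case (UN \<K>)
    then obtain k where "k \<in> \<K>" "hypograph X f \<in> k"
      by blast
    with UN.IH show ?case
      by (meson UnionI)
  next
    case (Basis s)
    then consider (hit) U where "openin ?P U" "s = {F. closedin ?P F \<and> F \<inter> U \<noteq> {}}"
      | (miss) K where "compactin ?P K" "s = {F. closedin ?P F \<and> F \<subseteq> topspace ?P - K}"
      by blast
    then show ?case
    proof cases
      case hit
      then obtain x y where xy: "(x, y) \<in> U" "y \<le> f x" "x \<in> topspace X"
        using Basis by (auto simp: hypograph_def)
      obtain A z where A: "openin X A" "x \<in> A" "z < y" "A \<times> {z} \<subseteq> U"
        by (rule openin_prod_topology_real_below[OF hit(1) xy(1)])
      \<comment> \<open>All points of \<open>B\<close> witness the hit at the same height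
        \<open>z\<close>. As \<open>B\<close> is open and non-empty while \<open>{x0}\<close> is not
        open, some witness \<open>w\<close> differs from \<open>x0\<close>; keeping the value at
        \<open>w\<close> keeps the hit.\<close>
      define B where "B = A \<inter> {w \<in> topspace X. f w \<in> {z<..}}"
      have "continuous_map X euclideanreal f"
        using f by (auto simp: continuous_functions_def continuous_map_in_subtopology)
      then have "openin X B"
        unfolding B_def using A(1) by (intro openin_Int openin_continuous_map_preimage) auto
      moreover have "x \<in> B"
        using A xy by (auto simp: B_def)
      ultimately obtain w where w: "w \<in> B" "w \<noteq> x0"
        using x0(2) by (metis empty_iff insertI1 subsetI subset_singletonD)
      have "hypograph X g \<in> s" if g: "g \<in> continuous_functions X Y" "g w = f w" for g
      proof -
        have "(w, z) \<in> hypograph X g \<inter> U"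
          using w(1) g(2) A(4) by (auto simp: B_def hypograph_def)
        then show ?thesis
          using clo[OF g(1)] by (auto simp: hit(2))
      qed
      then show ?thesis
        using w by (intro exI[of _ "{w}"]) (auto simp: B_def)
    next
      case miss
      \<comment> \<open>Lowering a function only shrinks its hypograph, so a miss persists and no
        value has to be kept.\<close>
      have "hypograph X g \<in> s" if g: "g \<in> continuous_functions X Y" "(\<forall>x\<in>topspace X. g x \<le> f x)" for g
      proof -
        have "hypograph X g \<subseteq> hypograph X f"
          using g(2) by (fastforce simp: hypograph_def)
        then show ?thesis
          using Basis(2) clo[OF g(1)] by (auto simp: miss(2))
      qed
      then show ?thesis
        by (intro exI[of _ "{}"]) auto
    qed
  qed
qed

lemma continuous_map_max_top_of_set:
  fixes f g :: "'a \<Rightarrow> real"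
  assumes "continuous_map X (top_of_set Y) f" "continuous_map X (top_of_set Y) g"
  shows "continuous_map X (top_of_set Y) (\<lambda>x. max (f x) (g x))"
  using assms unfolding continuous_map_in_subtopology
  by (intro conjI continuous_map_real_max) (auto simp: max_def Pi_iff)

lemma continuous_map_min_top_of_set:
  fixes f g :: "'a \<Rightarrow> real"
  assumes "continuous_map X (top_of_set Y) f" "continuous_map X (top_of_set Y) g"
  shows "continuous_map X (top_of_set Y) (\<lambda>x. min (f x) (g x))"
  using assms unfolding continuous_map_in_subtopology
  by (intro conjI continuous_map_real_min) (auto simp: min_def Pi_iff)

text \<open>The maximum of functions that separate \<open>x0\<close> from each point of
  \<open>A\<close>. Its value at every point is one of theirs, so it stays in \<open>Y\<close>
  although \<open>Y\<close> may have gaps.\<close>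

lemma separated_by_finite:
  assumes sep: "separated_by Y X" and "y0 \<in> Y" "x0 \<in> topspace X"
    and "finite A" "A \<subseteq> topspace X - {x0}" and f: "\<And>x. x \<in> topspace X \<Longrightarrow> f x \<in> Y"
  shows "\<exists>h. continuous_map X (top_of_set Y) h \<and> h x0 = y0 \<and> (\<forall>x\<in>A. f x \<le> h x)"
  using assms(4,5)
proof (induction A)
  case empty
  then show ?case
    using assms(2) by (intro exI[of _ "\<lambda>_. y0"]) auto
next
  case (insert a A)
  then obtain h where h: "continuous_map X (top_of_set Y) h" "h x0 = y0" "\<forall>x\<in>A. f x \<le> h x"
    by auto
  obtain k where k: "continuous_map X (top_of_set Y) k" "k x0 = y0" "k a = f a"
    using sep insert.prems assms(2,3) f[of a] unfolding separated_by_def by (metis DiffE insertI1 insert_subset)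
  show ?case
    using h k by (intro exI[of _ "\<lambda>x. max (h x) (k x)"]) (auto intro: continuous_map_max_top_of_set)
qed

lemma fell_hypograph_small_at_nonisolated_dense:
  assumes sep: "separated_by Y X" and x0: "x0 \<in> topspace X" "\<not> openin X {x0}"
    and y0: "y0 \<in> Y" "y0 < q"
  shows "fell_hypograph_topology X Y closure_of {f \<in> continuous_functions X Y. f x0 < q} =
    topspace (fell_hypograph_topology X Y)"
  unfolding dense_intersects_open
proof (intro allI impI)
  fix W assume W: "openin (fell_hypograph_topology X Y) W \<and> W \<noteq> {}"
  then obtain S where S: "openin (fell_topology (prod_topology X euclideanreal)) S"
    "W = hypograph X -` S \<inter> continuous_functions X Y"
    unfolding fell_hypograph_topology_def openin_pullback_topology by blast
  then obtain f where f: "f \<in> continuous_functions X Y" "hypograph X f \<in> S"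
    using W by blast
  obtain A where A: "finite A" "A \<subseteq> topspace X - {x0}"
    and lowering: "\<forall>g\<in>continuous_functions X Y. (\<forall>x\<in>topspace X. g x \<le> f x) \<and> (\<forall>x\<in>A. g x = f x) \<longrightarrow>
      hypograph X g \<in> S"
    using openin_fell_topology_lowering[OF S(1) f x0] by blast
  have fc: "continuous_map X (top_of_set Y) f"
    using f(1) by (simp add: continuous_functions_def)
  then have "f x \<in> Y" if "x \<in> topspace X" for x
    using that by (auto simp: continuous_map_in_subtopology)
  then obtain h where h: "continuous_map X (top_of_set Y) h" "h x0 = y0" "\<forall>x\<in>A. f x \<le> h x"
    using separated_by_finite[OF sep y0(1) x0(1) A(1,2)] by blast
  \<comment> \<open>The minimum lies below \<open>f\<close>, equals \<open>f\<close> on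
    \<open>A\<close> where \<open>h\<close> dominates it, and is at most \<open>y0 < q\<close> at
    \<open>x0\<close>.\<close>
  define g where "g = restrict (\<lambda>x. min (f x) (h x)) (topspace X)"
  have "continuous_map X (top_of_set Y) g"
    using continuous_map_min_top_of_set[OF fc h(1)] by (rule continuous_map_eq) (simp add: g_def)
  then have g: "g \<in> continuous_functions X Y"
    by (simp add: continuous_functions_def g_def)
  moreover have "hypograph X g \<in> S"
    using A(2) h(3) by (intro lowering[rule_format, OF g]) (auto simp: g_def min_def)
  moreover have "g x0 < q"
    using x0(1) y0(2) h(2) by (simp add: g_def)
  ultimately show "{f \<in> continuous_functions X Y. f x0 < q} \<inter> W \<noteq> {}"
    unfolding S(2) by blast
qed

lemma baire_fell_hypograph_imp_discrete:
  assumes "Y \<noteq> {}" "\<And>y. y \<in> Y \<Longrightarrow> \<exists>z\<in>Y. z < y" "separated_by Y X"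
    and baire: "baire_space (fell_hypograph_topology X Y)"
  shows "discrete_space X"
proof (rule ccontr)
  let ?F = "fell_hypograph_topology X Y"
  assume "\<not> discrete_space X"
  then obtain x0 where x0: "x0 \<in> topspace X" "\<not> openin X {x0}"
    unfolding discrete_space_def by (metis discrete_topology_unique)
  define D where "D q = {f \<in> continuous_functions X Y. f x0 < q}" for q
  \<comment> \<open>Rational bounds keep the family countable; an element of \<open>Y\<close> below
    \<open>q\<close> is what makes \<open>D q\<close> dense.\<close>
  define \<U> where "\<U> = D ` {q \<in> \<rat>. \<exists>y\<in>Y. y < q}"
  have "countable \<U>"
    by (auto simp: \<U>_def intro!: countable_image countable_subset[OF _ countable_rat])
  moreover have "openin ?F U \<and> ?F closure_of U = topspace ?F" if "U \<in> \<U>" for U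
    using that fell_hypograph_miss_point[OF x0(1)] fell_hypograph_small_at_nonisolated_dense[OF assms(3) x0]
    by (auto simp: \<U>_def D_def)
  ultimately have dense: "?F closure_of (topspace ?F \<inter> \<Inter>\<U>) = topspace ?F"
    using baire unfolding baire_space_def by blast
  have "f \<notin> \<Inter>\<U>" if f: "f \<in> topspace ?F" for f
  proof -
    have "f x0 \<in> Y"
      using f x0(1) by (auto simp: topspace_fell_hypograph_topology continuous_functions_def continuous_map_in_subtopology)
    then obtain z where z: "z \<in> Y" "z < f x0"
      using assms(2) by blast
    then obtain q where "q \<in> \<rat>" "z < q" "q < f x0"
      using Rats_dense_in_real by blast
    then have "D q \<in> \<U>" "f \<notin> D q"
      using z(1) by (auto simp: \<U>_def D_def)
    then show ?thesis by blast
  qed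
  then have "topspace ?F \<inter> \<Inter>\<U> = {}"
    by blast
  then have "topspace ?F = {}"
    using dense by simp
  moreover obtain y where "y \<in> Y"
    using assms(1) by blast
  then have "restrict (\<lambda>_. y) (topspace X) \<in> topspace ?F"
    by (auto simp: topspace_fell_hypograph_topology continuous_functions_def
        intro: continuous_map_eq[of X _ "\<lambda>_. y"])
  ultimately show False
    by blast
qed

section \<open>The characterizations\<close>

lemma second_countable_euclidean: "second_countable (euclidean :: 'a::second_countable_topology topology)"
proof -
  obtain \<B> :: "'a set set" where \<B>: "countable \<B>" "\<And>C. C \<in> \<B> \<Longrightarrow> open C"
    "\<And>S. open S \<Longrightarrow> \<exists>U. U \<subseteq> \<B> \<and> S = \<Union>U"
    by (rule univ_second_countable) (assumption | rule that)+
  have "\<exists>V\<in>\<B>. x \<in> V \<and> V \<subseteq> U" if U: "open U" "x \<in> U" for U x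
  proof -
    obtain \<V> where "\<V> \<subseteq> \<B>" "U = \<Union>\<V>"
      using \<B>(3)[OF U(1)] by blast
    then show ?thesis
      using U(2) by blast
  qed
  then show ?thesis
    unfolding second_countable_def open_openin[symmetric] using \<B>(1,2) by blast
qed

lemma second_countable_top_of_set: "second_countable (top_of_set (S :: 'a::second_countable_topology set))"
  by (intro second_countable_subtopology second_countable_euclidean)

lemma polish_gdelta_real:
  fixes G :: "real set"
  assumes "gdelta_in euclidean G"
  shows "polish (top_of_set G)"
  unfolding polish_def
  by (intro conjI second_countable_imp_separable_space second_countable_top_of_set
      completely_metrizable_space_gdelta_in completely_metrizable_space_euclidean assms)

text \<open>The game on \<open>Z\<close> is used twice: its strategy yields the gdelta set, and the
  Baire property it implies passes to the open image \<open>Y\<close>, where it makes that set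
  dense.\<close>

lemma choquet_open_image_imp_almost_polish:
  fixes Y :: "real set"
  assumes "choquet_space Z"
    and f: "continuous_map Z (top_of_set Y) f" "open_map Z (top_of_set Y) f" "f ` topspace Z = Y"
  shows "almost_polish (top_of_set Y)"
proof -
  obtain \<sigma> where "wins False Z \<sigma>"
    using assms(1) choquet_wins unfolding choquet_space_def by blast
  then obtain G where G: "gdelta_in euclidean G" "G \<subseteq> Y" "baire_space (top_of_set Y) \<Longrightarrow> Y \<subseteq> closure G"
    using wins_imp_gdelta_kernel[OF _ f] by metis
  have "baire_space (top_of_set Y)"
    using baire_space_open_map_image[OF choquet_imp_baire_space[OF assms(1)] f(1,2)] f(3) by simp
  then have "top_of_set Y closure_of G = Y"
    using G by (auto simp: closure_of_subtopology inf_absorb2)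
  moreover have "polish (subtopology (top_of_set Y) G)"
    using polish_gdelta_real[OF G(1)] G(2) by (simp add: subtopology_subtopology inf_absorb2)
  ultimately show ?thesis
    unfolding almost_polish_def using G(2) by auto
qed

lemma strong_choquet_open_image_imp_polish:
  fixes Y :: "real set"
  assumes "strong_choquet_space Z"
    and f: "continuous_map Z (top_of_set Y) f" "open_map Z (top_of_set Y) f" "f ` topspace Z = Y"
  shows "polish (top_of_set Y)"
proof -
  obtain \<sigma> where "wins True Z \<sigma>"
    using assms(1) strong_choquet_wins unfolding strong_choquet_space_def by blast
  then obtain G where "gdelta_in euclidean G" "G = Y"
    using wins_imp_gdelta_kernel[OF _ f] by metis
  then show ?thesis
    using polish_gdelta_real by blast
qed

section \<open>Powers and their dense subspaces\<close>

lemma product_projection_image: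
  assumes "i \<in> I" "topspace (product_topology X I) \<noteq> {}"
  shows "(\<lambda>f. f i) ` topspace (product_topology X I) = topspace (X i)"
  using assms by (auto simp: image_projection_PiE)

lemma almost_completely_metrizable_imp_choquet:
  assumes "almost_completely_metrizable_space Z"
  shows "choquet_space Z"
proof -
  obtain D where "D \<subseteq> topspace Z" "Z closure_of D = topspace Z" "completely_metrizable_space (subtopology Z D)"
    using assms by (auto simp: almost_completely_metrizable_space_def)
  then show ?thesis
    using choquet_space_dense_subspace strong_choquet_imp_choquet
      completely_metrizable_imp_strong_choquet by metis
qed

lemma almost_polish_imp_almost_completely_metrizable:
  assumes "almost_polish Z"
  shows "almost_completely_metrizable_space Z"
proof -
  obtain D where "D \<subseteq> topspace Z" "Z closure_of D = topspace Z" "polish (subtopology Z D)"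
    using assms by (auto simp: almost_polish_def)
  then show ?thesis
    by (auto simp: almost_completely_metrizable_space_def polish_def)
qed

lemma product_dense_subspace:
  assumes "D \<subseteq> topspace Z" "Z closure_of D = topspace Z"
  shows "(\<Pi>\<^sub>E i\<in>I. D) \<subseteq> topspace (product_topology (\<lambda>_. Z) I)"
    "product_topology (\<lambda>_. Z) I closure_of (\<Pi>\<^sub>E i\<in>I. D) = topspace (product_topology (\<lambda>_. Z) I)"
    "subtopology (product_topology (\<lambda>_. Z) I) (\<Pi>\<^sub>E i\<in>I. D) = product_topology (\<lambda>_. subtopology Z D) I"
  using PiE_mono[of I "\<lambda>_. D" "\<lambda>_. topspace Z"] assms
  by (simp_all add: closure_of_product_topology subtopology_product_topology)

text \<open>The power of the dense Polish subspace is dense. It may fail to be metrizable, but it is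
  strong Choquet, and the weaker game passes from dense subspaces to the whole space.\<close>

lemma choquet_product_almost_polish:
  assumes "almost_polish Z"
  shows "choquet_space (product_topology (\<lambda>_. Z) I)"
proof -
  obtain D where D: "D \<subseteq> topspace Z" "Z closure_of D = topspace Z" "polish (subtopology Z D)"
    using assms by (auto simp: almost_polish_def)
  have "choquet_space (product_topology (\<lambda>_. subtopology Z D) I)"
    using D(3) by (intro strong_choquet_imp_choquet strong_choquet_product_completely_metrizable)
      (simp add: polish_def)
  then show ?thesis
    using choquet_space_dense_subspace[OF product_dense_subspace(1,2)[OF D(1,2)]]
    by (simp add: product_dense_subspace(3)[OF D(1,2)])
qed

lemma polish_product:
  fixes Y :: "'a::second_countable_topology set"
  assumes "countable I" "completely_metrizable_space (top_of_set Y)"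
  shows "polish (product_topology (\<lambda>_. top_of_set Y) I)"
proof -
  have "second_countable (product_topology (\<lambda>_. top_of_set Y) I)"
    using assms(1) by (intro second_countable_product second_countable_top_of_set)
  moreover have "completely_metrizable_space (product_topology (\<lambda>_. top_of_set Y) I)"
    using assms by (auto simp: completely_metrizable_space_product_topology intro: countable_subset[OF _ assms(1)])
  ultimately show ?thesis
    by (simp add: polish_def second_countable_imp_separable_space)
qed

lemma almost_polish_product:
  fixes Y :: "'a::second_countable_topology set"
  assumes "countable I" "almost_polish (top_of_set Y)"
  shows "almost_polish (product_topology (\<lambda>_. top_of_set Y) I)"
proof -
  obtain D where D: "D \<subseteq> topspace (top_of_set Y)" "top_of_set Y closure_of D = topspace (top_of_set Y)"
    "polish (subtopology (top_of_set Y) D)"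
    using assms(2) by (auto simp: almost_polish_def)
  have eq: "subtopology (top_of_set Y) D = top_of_set D"
    using D(1) by (simp add: subtopology_subtopology inf_absorb2)
  have "polish (product_topology (\<lambda>_. top_of_set D) I)"
    using assms(1) D(3) unfolding eq by (intro polish_product) (auto simp: polish_def)
  then show ?thesis
    unfolding almost_polish_def using product_dense_subspace[OF D(1,2), of I] eq by metis
qed

text \<open>Each member of a countable neighbourhood base at \<open>d\<close> contains the trace of
  a box restricting finitely many coordinates. A coordinate restricted by none of these boxes could
  be moved away from \<open>d i\<close> without leaving them, which density of \<open>D\<close>
  realizes inside \<open>D\<close>.\<close>

lemma countable_index_of_first_countable_dense:
  assumes D: "D \<subseteq> topspace (product_topology X I)"
      "product_topology X I closure_of D = topspace (product_topology X I)"
    and fc: "first_countable (subtopology (product_topology X I) D)"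
    and ne: "topspace (product_topology X I) \<noteq> {}"
    and two: "\<And>i x. \<lbrakk>i \<in> I; x \<in> topspace (X i)\<rbrakk> \<Longrightarrow>
      \<exists>U V. openin (X i) U \<and> openin (X i) V \<and> x \<in> U \<and> V \<noteq> {} \<and> U \<inter> V = {}"
  shows "countable I"
proof -
  let ?T = "product_topology X I"
  obtain d where d: "d \<in> D"
    using D(2) ne by fastforce
  then have dT: "d \<in> topspace ?T"
    using D(1) by blast
  then obtain \<B> where \<B>: "countable \<B>" "\<And>V. V \<in> \<B> \<Longrightarrow> openin (subtopology ?T D) V"
    "\<And>U. \<lbrakk>openin (subtopology ?T D) U; d \<in> U\<rbrakk> \<Longrightarrow> \<exists>V\<in>\<B>. d \<in> V \<and> V \<subseteq> U"
    using fc d unfolding first_countable_def by (metis IntI topspace_subtopology)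
  define \<B>' where "\<B>' = {V \<in> \<B>. d \<in> V}"
  define fits where "fits V W \<longleftrightarrow> finite {i \<in> I. W i \<noteq> topspace (X i)} \<and> (\<forall>i\<in>I. openin (X i) (W i)) \<and>
      d \<in> Pi\<^sub>E I W \<and> Pi\<^sub>E I W \<inter> D \<subseteq> V" for V W
  have ex_fits: "\<exists>W. fits V W" if V: "V \<in> \<B>'" for V
  proof -
    obtain O' where O': "openin ?T O'" "V = O' \<inter> D"
      using \<B>(2)[of V] V unfolding \<B>'_def openin_subtopology by blast
    then have "d \<in> O'"
      using V by (auto simp: \<B>'_def)
    then obtain W where "finite {i \<in> I. W i \<noteq> topspace (X i)}" "\<forall>i\<in>I. openin (X i) (W i)"
      "d \<in> Pi\<^sub>E I W" "Pi\<^sub>E I W \<subseteq> O'"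
      using bspec[OF iffD1[OF openin_product_topology_alt O'(1)]] by blast
    moreover from this(4) have "Pi\<^sub>E I W \<inter> D \<subseteq> V"
      using O'(2) by blast
    ultimately show ?thesis
      unfolding fits_def by blast
  qed
  define W where "W V = (SOME W. fits V W)" for V
  have "fits V (W V)" if "V \<in> \<B>'" for V
    unfolding W_def by (rule someI_ex[OF ex_fits[OF that]])
  then have W: "\<And>V. V \<in> \<B>' \<Longrightarrow> finite {i \<in> I. W V i \<noteq> topspace (X i)}"
    "\<And>V i. \<lbrakk>V \<in> \<B>'; i \<in> I\<rbrakk> \<Longrightarrow> openin (X i) (W V i)"
    "\<And>V. V \<in> \<B>' \<Longrightarrow> d \<in> Pi\<^sub>E I (W V)" "\<And>V. V \<in> \<B>' \<Longrightarrow> Pi\<^sub>E I (W V) \<inter> D \<subseteq> V"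
    by (simp_all add: fits_def)
  have "I \<subseteq> (\<Union>V\<in>\<B>'. {i \<in> I. W V i \<noteq> topspace (X i)})"
  proof
    fix i assume i: "i \<in> I"
    then have di: "d i \<in> topspace (X i)"
      using dT by (auto simp: PiE_iff)
    obtain U U' where U: "openin (X i) U" "openin (X i) U'" "d i \<in> U" "U' \<noteq> {}" "U \<inter> U' = {}"
      using two[OF i di] by blast
    define S where "S = {f \<in> topspace ?T. f i \<in> U}"
    have S: "openin ?T S"
      unfolding S_def
      by (rule openin_continuous_map_preimage[OF continuous_map_product_projection[OF i, of X] U(1)])
    then have "openin (subtopology ?T D) (S \<inter> D)" "d \<in> S \<inter> D"
      using d dT U(3) by (auto simp: openin_subtopology S_def)
    then have "\<exists>V\<in>\<B>. d \<in> V \<and> V \<subseteq> S \<inter> D"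
      by (rule \<B>(3))
    then obtain V where V: "V \<in> \<B>'" "V \<subseteq> S"
      by (auto simp: \<B>'_def)
    have "W V i \<noteq> topspace (X i)"
    proof
      assume top: "W V i = topspace (X i)"
      \<comment> \<open>The free side at \<open>i\<close> is replaced by \<open>U'\<close>, disjoint
        from \<open>U\<close>. The new box is open and non-empty, so it meets \<open>D\<close> in a
        point that should lie in \<open>S\<close> but cannot.\<close>
      define W' where "W' = (\<lambda>j. if j = i then U' else W V j)"
      obtain u where u: "u \<in> U'"
        using U(4) by blast
      have "openin ?T (Pi\<^sub>E I W')"
      proof -
        have "{j \<in> I. W' j \<noteq> topspace (X j)} \<subseteq> insert i {j \<in> I. W V j \<noteq> topspace (X j)}"
          by (auto simp: W'_def)
        then have "finite {j \<in> I. W' j \<noteq> topspace (X j)}"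
          using W(1)[OF V(1)] by (meson finite.insertI finite_subset)
        moreover have "\<forall>j\<in>I. openin (X j) (W' j)"
          using W(2)[OF V(1)] U(2) by (simp add: W'_def)
        ultimately show ?thesis
          by (simp add: openin_PiE_gen)
      qed
      moreover have "d(i := u) \<in> Pi\<^sub>E I W'"
        using W(3)[OF V(1)] u i by (auto simp: W'_def PiE_iff extensional_def)
      ultimately obtain g where g: "g \<in> Pi\<^sub>E I W'" "g \<in> D"
        using D(2) unfolding dense_intersects_open by blast
      have "g i \<in> U'"
        using g(1) i by (auto simp: W'_def PiE_iff)
      have "g j \<in> W V j" if "j \<in> I" for j
      proof (cases "j = i")
        case True
        then show ?thesis
          using \<open>g i \<in> U'\<close> top openin_subset[OF U(2)] by auto
      next
        case False
        then show ?thesis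
          using g(1) that by (auto simp: W'_def PiE_iff)
      qed
      then have "g \<in> Pi\<^sub>E I (W V)"
        using g(1) by (auto simp: PiE_iff)
      then have "g \<in> S"
        using W(4)[OF V(1)] V(2) g(2) by blast
      then show False
        using \<open>g i \<in> U'\<close> U(5) by (auto simp: S_def)
    qed
    then show "i \<in> (\<Union>V\<in>\<B>'. {i \<in> I. W V i \<noteq> topspace (X i)})"
      using V(1) i by blast
  qed
  moreover have "countable (\<Union>V\<in>\<B>'. {i \<in> I. W V i \<noteq> topspace (X i)})"
    using \<B>(1) W(1) by (intro countable_UN) (auto simp: \<B>'_def intro: countable_finite)
  ultimately show ?thesis
    by (rule countable_subset)
qed

lemma countable_index_of_almost_completely_metrizable:
  fixes Y :: "real set"
  assumes "almost_completely_metrizable_space (product_topology (\<lambda>_. top_of_set Y) I)"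
    and "Y \<noteq> {}" "\<And>y. y \<in> Y \<Longrightarrow> \<exists>z\<in>Y. z < y"
  shows "countable I"
proof -
  let ?T = "product_topology (\<lambda>_. top_of_set Y) I"
  obtain D where D: "D \<subseteq> topspace ?T" "?T closure_of D = topspace ?T" "completely_metrizable_space (subtopology ?T D)"
    using assms(1) by (auto simp: almost_completely_metrizable_space_def)
  have "first_countable (subtopology ?T D)"
    using D(3) completely_metrizable_imp_metrizable_space metrizable_imp_first_countable by blast
  moreover have "topspace ?T \<noteq> {}"
    using assms(2) by (simp add: PiE_eq_empty_iff)
  moreover have "\<exists>U V. openin (top_of_set Y) U \<and> openin (top_of_set Y) V \<and> x \<in> U \<and> V \<noteq> {} \<and> U \<inter> V = {}"
    if x: "x \<in> topspace (top_of_set Y)" for x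
  proof -
    obtain z where "z \<in> Y" "z < x"
      using assms(3) x by auto
    \<comment> \<open>The midpoint separates \<open>x\<close> from the smaller element
      \<open>z\<close> of \<open>Y\<close> by two open rays.\<close>
    moreover define m where "m = (x + z) / 2"
    ultimately show ?thesis
      using x by (intro exI[of _ "Y \<inter> {m<..}"] exI[of _ "Y \<inter> {..<m}"]) (auto simp: openin_open_Int)
  qed
  ultimately show ?thesis
    by (rule countable_index_of_first_countable_dense[OF D(1,2)])
qed

theorem theorem1p2:
  fixes X :: "'a topology" and Y :: "real set"
  assumes "Y \<noteq> {}" and "Inf (ereal ` Y) \<notin> ereal ` Y"
    and "topspace X \<noteq> {}" and "separated_by Y X"
  shows
    "(baire_space (fell_hypograph_topology X Y) \<longleftrightarrow>
        discrete_space X \<and> baire_space (top_of_set Y)) \<and>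
     (choquet_space (fell_hypograph_topology X Y) \<longleftrightarrow>
        discrete_space X \<and> almost_polish (top_of_set Y)) \<and>
     (strong_choquet_space (fell_hypograph_topology X Y) \<longleftrightarrow>
        discrete_space X \<and> polish (top_of_set Y)) \<and>
     ((almost_completely_metrizable_space (fell_hypograph_topology X Y) \<longleftrightarrow>
         almost_polish (fell_hypograph_topology X Y)) \<and>
      (almost_polish (fell_hypograph_topology X Y) \<longleftrightarrow>
         countable (topspace X) \<and> discrete_space X \<and> almost_polish (top_of_set Y))) \<and>
     ((completely_metrizable_space (fell_hypograph_topology X Y) \<longleftrightarrow>
         polish (fell_hypograph_topology X Y)) \<and>
      (polish (fell_hypograph_topology X Y) \<longleftrightarrow>
         countable (topspace X) \<and> discrete_space X \<and> polish (top_of_set Y)))"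
proof -
  let ?F = "fell_hypograph_topology X Y"
  \<comment> \<open>The hypothesis on the infimum enters only as the absence of a least
    element.\<close>
  have below: "\<exists>z\<in>Y. z < y" if y: "y \<in> Y" for y
  proof (rule ccontr)
    assume "\<not> (\<exists>z\<in>Y. z < y)"
    then have "Inf (ereal ` Y) = ereal y"
      using y by (intro Inf_eqI) (auto simp: not_less)
    then show False
      using assms(2) y by simp
  qed
  have cm_imp_almost: "almost_completely_metrizable_space Z" if "completely_metrizable_space Z" for Z :: "('a \<Rightarrow> real) topology"
    using that unfolding almost_completely_metrizable_space_def
    by (intro exI[of _ "topspace Z"]) auto
  show ?thesis
  proof (cases "discrete_space X")
    \<comment> \<open>Each of the properties implies the Baire property, so for non-discrete
      \<open>X\<close> every condition in the five equivalences is false.\<close>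
    case False
    then have "\<not> baire_space ?F"
      using baire_fell_hypograph_imp_discrete[OF assms(1) below assms(4)] by blast
    then have "\<not> choquet_space ?F"
      using choquet_imp_baire_space by blast
    then have "\<not> strong_choquet_space ?F" "\<not> almost_completely_metrizable_space ?F"
      using strong_choquet_imp_choquet almost_completely_metrizable_imp_choquet by blast+
    moreover from this have "\<not> almost_polish ?F" "\<not> completely_metrizable_space ?F" "\<not> polish ?F"
      using almost_polish_imp_almost_completely_metrizable cm_imp_almost polish_def by blast+
    ultimately show ?thesis
      using False \<open>\<not> baire_space ?F\<close> \<open>\<not> choquet_space ?F\<close> by blast
  next
    case True
    let ?I = "topspace X" and ?Y = "top_of_set Y"
    let ?T = "product_topology (\<lambda>_. ?Y) ?I"
    have F: "?F = ?T"
      by (rule fell_hypograph_topology_discrete[OF True])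
    obtain i where i: "i \<in> ?I"
      using assms(3) by blast
    have "topspace ?T \<noteq> {}"
      using assms(1) by (simp add: PiE_eq_empty_iff)
    then have proj: "continuous_map ?T ?Y (\<lambda>f. f i)" "open_map ?T ?Y (\<lambda>f. f i)" "(\<lambda>f. f i) ` topspace ?T = Y"
      using continuous_map_product_projection[OF i] open_map_product_projection[OF i]
        product_projection_image[OF i, of "\<lambda>_. ?Y"] by simp_all
    have 1: "baire_space ?T \<longleftrightarrow> baire_space ?Y"
      using baire_space_open_map_image[OF _ proj(1,2)] proj(3)
        baire_space_product[of ?I "\<lambda>_. ?Y", OF second_countable_top_of_set] by auto
    have 2: "choquet_space ?T \<longleftrightarrow> almost_polish ?Y"
      using choquet_open_image_imp_almost_polish[OF _ proj] choquet_product_almost_polish by blast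
    have 3: "strong_choquet_space ?T \<longleftrightarrow> polish ?Y"
      using strong_choquet_open_image_imp_polish[OF _ proj]
        strong_choquet_product_completely_metrizable[of ?I "\<lambda>_. ?Y"] by (auto simp: polish_def)
    have 4: "countable ?I \<and> almost_polish ?Y" if "almost_completely_metrizable_space ?T"
      using countable_index_of_almost_completely_metrizable[OF that assms(1) below]
        almost_completely_metrizable_imp_choquet[OF that] 2 by blast
    have 5: "countable ?I \<and> polish ?Y" if "completely_metrizable_space ?T"
      using 4[OF cm_imp_almost[OF that]] completely_metrizable_imp_strong_choquet[OF that] 3 by blast
    have 6: "almost_completely_metrizable_space ?T" if "almost_polish ?T"
      by (rule almost_polish_imp_almost_completely_metrizable[OF that])
    have 7: "almost_polish ?T" if "countable ?I \<and> almost_polish ?Y"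
      using that by (intro almost_polish_product) simp_all
    have 8: "polish ?T" if "countable ?I \<and> polish ?Y"
      using that by (intro polish_product) (simp_all add: polish_def)
    have 9: "completely_metrizable_space ?T" if "polish ?T"
      using that by (simp add: polish_def)
    show ?thesis
      unfolding F using True 1 2 3 4 5 6 7 8 9 by argo
  qed
qed

end
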